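(* Suppose that $\kappa$ is not weakly compact. Up to homeomorphism, the generalized Cantor space ${}^{\kappa}2$ (and hence also ${}^{\kappa}\kappa$) is the unique nonempty $\kappa$-additive perfect (equivalently, $\kappa$-perfect) $\mathrm{SC}_\kappa$-space.
   Context: Work in ZFC; $\kappa$ is an uncountable regular cardinal with $2^{<\kappa}=\kappa$ (equivalently $\kappa^{<\kappa}=\kappa$). "Space" means regular Hausdorff topological space. $\kappa$ is weakly compact if it is strongly inaccessible and every tree $T\subseteq{}^{<\kappa}\kappa$ (set closed under initial segments) all of whose levels $T\cap{}^{\alpha}\kappa$, $\alpha<\kappa$, are nonempty and of size $<\kappa$ has a branch of length $\kappa$. ${}^{\kappa}\kappa$ is the set of all functions $\kappa\to\kappa$ with the bounded topology, generated by the sets $\{x\in{}^{\kappa}\kappa \mid s\subseteq x\}$, $s\in{}^{<\kappa}\kappa$; ${}^{\kappa}2\subseteq{}^{\kappa}\kappa$ has the relative topology. A space is $\kappa$-additive if its topology is closed under intersections of fewer than $\kappa$ open sets. It is perfect if it has no isolated points, and $\kappa$-perfect if no singleton is an intersection of fewer than $\kappa$ open sets (the two notions coincide for $\kappa$-additive spaces). Strong $\kappa$-Choquet game $\mathrm{G}^s_\kappa(X)$: players I and II play $\kappa$-many rounds. In round $\alpha<\kappa$, I plays $(U_\alpha,x_\alpha)$ with $U_\alpha$ a relatively open subset of $\bigcap_{\beta<\alpha}V_\beta$ (which is $X$ if $\alpha=0$) and $x_\alpha\in U_\alpha$; then II plays a relatively open subset $V_\alpha$ of $\bigcap_{\beta<\alpha}V_\beta$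 with $x_\alpha\in V_\alpha\subseteq U_\alpha$. II wins iff $\bigcap_{\alpha<\gamma}V_\alpha\ne\emptyset$ for every limit $\gamma\le\kappa$ (I wins as soon as such an intersection is empty). $X$ is an $\mathrm{SC}_\kappa$-space if it has weight $\le\kappa$ and II has a winning strategy in $\mathrm{G}^s_\kappa(X)$. *)

theory Defs
  imports "HOL-Analysis.Analysis"
begin

text \<open>
  The cardinal \<open>\<kappa>\<close> is a cardinal order \<open>\<kappa> :: 'k rel\<close> in the sense of the library.
  The ordinals below \<open>\<kappa>\<close> are the elements of \<open>Field \<kappa>\<close>, and \<open>\<alpha>\<close> regarded as a set of
  ordinals is \<open>underS \<kappa> \<alpha>\<close>. The ordinals up to and including \<open>\<kappa>\<close> are the initial segments
  \<open>D\<close> of \<open>Field \<kappa>\<close>, that is the sets with \<open>wo_rel.ofilter \<kappa> D\<close>.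
\<close>

unbundle cardinal_syntax

section \<open>Sequences\<close>

text \<open>
  Functions \<open>A \<rightarrow> B\<close> are partial maps with domain \<open>A\<close>, so that \<open>s \<subseteq>\<^sub>m x\<close> is literally the
  inclusion of functions as sets of pairs, and a sequence determines its own length.
\<close>

definition maps :: "'k set \<Rightarrow> 'b set \<Rightarrow> ('k \<rightharpoonup> 'b) set" where
  "maps A B = {f. dom f = A \<and> ran f \<subseteq> B}"

definition bounded_seqs :: "'k rel \<Rightarrow> 'b set \<Rightarrow> ('k \<rightharpoonup> 'b) set" where
  "bounded_seqs \<kappa> B = (\<Union>\<alpha>\<in>Field \<kappa>. maps (underS \<kappa> \<alpha>) B)"

definition two :: "'k rel \<Rightarrow> 'k set" where
  "two \<kappa> = (let zero = wo_rel.minim \<kappa> (Field \<kappa>) in {zero, wo_rel.suc \<kappa> {zero}})"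

section \<open>Weak compactness\<close>

definition strongly_inaccessible :: "'k rel \<Rightarrow> bool" where
  "strongly_inaccessible \<kappa> \<longleftrightarrow>
     Card_order \<kappa> \<and> natLeq <o \<kappa> \<and> regularCard \<kappa> \<and>
     (\<forall>l :: 'k rel. Card_order l \<and> l <o \<kappa> \<longrightarrow> ctwo ^c l <o \<kappa>)"

definition seq_tree :: "'k rel \<Rightarrow> ('k \<rightharpoonup> 'k) set \<Rightarrow> bool" where
  "seq_tree \<kappa> T \<longleftrightarrow>
     T \<subseteq> bounded_seqs \<kappa> (Field \<kappa>) \<and> (\<forall>s\<in>T. \<forall>\<alpha>\<in>Field \<kappa>. s |` underS \<kappa> \<alpha> \<in> T)"

definition weakly_compact :: "'k rel \<Rightarrow> bool" where
  "weakly_compact \<kappa> \<longleftrightarrow>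
     strongly_inaccessible \<kappa> \<and>
     (\<forall>T. seq_tree \<kappa> T \<and>
          (\<forall>\<alpha>\<in>Field \<kappa>. T \<inter> maps (underS \<kappa> \<alpha>) (Field \<kappa>) \<noteq> {} \<and>
                       |T \<inter> maps (underS \<kappa> \<alpha>) (Field \<kappa>)| <o \<kappa>) \<longrightarrow>
          (\<exists>x\<in>maps (Field \<kappa>) (Field \<kappa>). \<forall>\<alpha>\<in>Field \<kappa>. x |` underS \<kappa> \<alpha> \<in> T))"

section \<open>Generalized Baire and Cantor spaces\<close>

definition gen_baire :: "'k rel \<Rightarrow> ('k \<rightharpoonup> 'k) topology" where
  "gen_baire \<kappa> =
     topology_generated_by
       ((\<lambda>s. {x \<in> maps (Field \<kappa>) (Field \<kappa>). s \<subseteq>\<^sub>m x}) ` bounded_seqs \<kappa> (Field \<kappa>))"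

definition gen_cantor :: "'k rel \<Rightarrow> ('k \<rightharpoonup> 'k) topology" where
  "gen_cantor \<kappa> = subtopology (gen_baire \<kappa>) (maps (Field \<kappa>) (two \<kappa>))"

section \<open>Additivity and perfectness\<close>

text \<open>Intersecting with \<open>topspace X\<close> only matters for the empty family.\<close>

definition additive_space :: "'k rel \<Rightarrow> 'a topology \<Rightarrow> bool" where
  "additive_space \<kappa> X \<longleftrightarrow>
     (\<forall>\<U>. (\<forall>U\<in>\<U>. openin X U) \<and> |\<U>| <o \<kappa> \<longrightarrow> openin X (topspace X \<inter> \<Inter>\<U>))"

definition perfect_space :: "'a topology \<Rightarrow> bool" where
  "perfect_space X \<longleftrightarrow> (\<forall>x\<in>topspace X. \<not> openin X {x})"

definition kappa_perfect_space :: "'k rel \<Rightarrow> 'a topology \<Rightarrow> bool" where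
  "kappa_perfect_space \<kappa> X \<longleftrightarrow>
     \<not> (\<exists>x\<in>topspace X. \<exists>\<U>. (\<forall>U\<in>\<U>. openin X U) \<and> |\<U>| <o \<kappa> \<and>
            topspace X \<inter> \<Inter>\<U> = {x})"

section \<open>The strong Choquet game\<close>

text \<open>
  \<open>p \<alpha> = (U, x)\<close> is the move of I and \<open>V \<alpha>\<close> the move of II in round \<open>\<alpha>\<close>; \<open>game_region\<close> is
  the intersection of the sets played by II before round \<open>\<alpha>\<close>.
\<close>

definition game_region :: "'k rel \<Rightarrow> 'a topology \<Rightarrow> ('k \<Rightarrow> 'a set) \<Rightarrow> 'k \<Rightarrow> 'a set" where
  "game_region \<kappa> X V \<alpha> = topspace X \<inter> (\<Inter>\<beta>\<in>underS \<kappa> \<alpha>. V \<beta>)"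

definition legal_I ::
    "'k rel \<Rightarrow> 'a topology \<Rightarrow> ('k \<Rightarrow> 'a set \<times> 'a) \<Rightarrow> ('k \<Rightarrow> 'a set) \<Rightarrow> 'k \<Rightarrow> bool" where
  "legal_I \<kappa> X p V \<alpha> \<longleftrightarrow>
     openin (subtopology X (game_region \<kappa> X V \<alpha>)) (fst (p \<alpha>)) \<and> snd (p \<alpha>) \<in> fst (p \<alpha>)"

definition legal_II ::
    "'k rel \<Rightarrow> 'a topology \<Rightarrow> ('k \<Rightarrow> 'a set \<times> 'a) \<Rightarrow> ('k \<Rightarrow> 'a set) \<Rightarrow> 'k \<Rightarrow> bool" where
  "legal_II \<kappa> X p V \<alpha> \<longleftrightarrow>
     openin (subtopology X (game_region \<kappa> X V \<alpha>)) (V \<alpha>) \<and>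
     snd (p \<alpha>) \<in> V \<alpha> \<and> V \<alpha> \<subseteq> fst (p \<alpha>)"

text \<open>
  A strategy for II maps \<open>\<alpha>\<close> and the sequence of moves of I in rounds up to and including
  \<open>\<alpha>\<close> to the move of II in round \<open>\<alpha>\<close>. (The earlier moves of II are determined by the
  strategy, so they need not be part of its input.)
\<close>

type_synonym ('k, 'a) strategy_II = "'k \<Rightarrow> ('k \<Rightarrow> 'a set \<times> 'a) \<Rightarrow> 'a set"

definition response ::
    "'k rel \<Rightarrow> ('k, 'a) strategy_II \<Rightarrow> ('k \<Rightarrow> 'a set \<times> 'a) \<Rightarrow> 'k \<Rightarrow> 'a set" where
  "response \<kappa> \<sigma> p \<alpha> = \<sigma> \<alpha> (restrict p (under \<kappa> \<alpha>))"

definition limit_segment :: "'k rel \<Rightarrow> 'k set \<Rightarrow> bool" where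
  "limit_segment \<kappa> D \<longleftrightarrow>
     wo_rel.ofilter \<kappa> D \<and> D \<noteq> {} \<and> (\<forall>\<alpha>\<in>D. \<exists>\<beta>\<in>D. \<alpha> \<in> underS \<kappa> \<beta>)"

text \<open>
  \<open>D\<close> ranges over the possible lengths \<open>\<le> \<kappa>\<close> of partial plays in which I has played
  legally. A play that reaches a limit length with empty intersection is already lost for II,
  even though I then has no legal move to continue it.
\<close>

definition winning_strategy_II ::
    "'k rel \<Rightarrow> 'a topology \<Rightarrow> ('k, 'a) strategy_II \<Rightarrow> bool" where
  "winning_strategy_II \<kappa> X \<sigma> \<longleftrightarrow>
     (\<forall>p D. wo_rel.ofilter \<kappa> D \<and> (\<forall>\<alpha>\<in>D. legal_I \<kappa> X p (response \<kappa> \<sigma> p) \<alpha>) \<longrightarrow>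
        (\<forall>\<alpha>\<in>D. legal_II \<kappa> X p (response \<kappa> \<sigma> p) \<alpha>) \<and>
        (limit_segment \<kappa> D \<longrightarrow> (\<Inter>\<alpha>\<in>D. response \<kappa> \<sigma> p \<alpha>) \<noteq> {}))"

definition weight_le :: "'a topology \<Rightarrow> 'k rel \<Rightarrow> bool" where
  "weight_le X \<kappa> \<longleftrightarrow>
     (\<exists>\<B>. |\<B>| \<le>o \<kappa> \<and> (\<forall>V\<in>\<B>. openin X V) \<and>
          (\<forall>U x. openin X U \<and> x \<in> U \<longrightarrow> (\<exists>V\<in>\<B>. x \<in> V \<and> V \<subseteq> U)))"

text \<open>Spaces are by convention regular and Hausdorff.\<close>

definition SC_space :: "'k rel \<Rightarrow> 'a topology \<Rightarrow> bool" where
  "SC_space \<kappa> X \<longleftrightarrow>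
     regular_space X \<and> Hausdorff_space X \<and> weight_le X \<kappa> \<and>
     (\<exists>\<sigma>. winning_strategy_II \<kappa> X \<sigma>)"

end

theory Submission
  imports Defs
begin

text \<open>
  Why the theorem holds. Let \<open>X\<close> be a nonempty perfect \<open>\<kappa>\<close>-additive \<open>SC\<close>-space. Regularity
  together with \<open>\<kappa>\<close>-additivity for an uncountable \<open>\<kappa>\<close> makes \<open>X\<close> zero-dimensional, and the weight
  bound then lets every assignment of neighbourhoods be refined to a partition into at most
  \<open>\<kappa>\<close> clopen pieces (\<open>disjoint_refinement\<close>). Splitting cells again and again along such
  partitions codes each point by a sequence of indices. Every cell is chosen inside the answer
  of II's winning strategy to a move in which I plays the preceding cell; hence the cells along
  a path of limit length form a run that II wins and have a common point. This is
  \<open>tree_coding_exists\<close>: it produces indices \<open>f\<close>, which determine points and whose limits are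
  all realised, together with labels \<open>l\<close>, whose set of values on each cell can be prescribed
  (\<open>labels_realized\<close>), as long as open sets can be partitioned into that many pieces.

  If every nonempty open set can be partitioned into \<open>\<kappa>\<close> nonempty open pieces, the indices
  can be taken to exhaust \<open>\<kappa>\<close> on each cell, and the coding is then a homeomorphism of \<open>X\<close>
  with the generalized Baire space (\<open>homeomorphic_gen_baire\<close>).

  Such partitions are what the failure of weak compactness supplies. Partitions into fewer
  than \<open>\<kappa>\<close> pieces always exist, by perfectness (\<open>small_splits\<close>). If \<open>\<kappa>\<close> is not strongly
  inaccessible, binary labels read up to a level \<open>a\<close> whose power set has size at least \<open>\<kappa>\<close>
  give the partition (\<open>large_power_splits\<close>). Otherwise there is a tree with small levels and
  without a branch of length \<open>\<kappa>\<close>; labels are made to follow this tree, every point leaves it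
  at some level below \<open>\<kappa>\<close>, and these levels are unbounded because all levels of the tree are
  nonempty; by regularity the exit level takes \<open>\<kappa>\<close> values (\<open>tree_splits\<close>).

  The generalized Cantor space is itself a space of this kind: II wins by answering
  with cylinders. Hence it is homeomorphic to the generalized Baire space, and both are
  homeomorphic to every other such space.
\<close>

section \<open>Ordinals below a regular uncountable cardinal\<close>

locale regular_uncountable =
  fixes \<kappa> :: "'k rel"
  assumes card_order: "Card_order \<kappa>"
    and uncountable: "natLeq <o \<kappa>"
    and regular: "regularCard \<kappa>"
begin

lemma well_order: "wo_rel \<kappa>"
  using card_order by (simp add: card_order_on_well_order_on wo_rel_def)

lemma infinite_Field: "infinite (Field \<kappa>)"
proof -
  have "natLeq \<le>o |Field \<kappa>|"
    using ordLeq_ordIso_trans[OF ordLess_imp_ordLeq[OF uncountable]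
        ordIso_symmetric[OF card_of_Field_ordIso[OF card_order]]] .
  then show ?thesis using infinite_iff_natLeq_ordLeq by blast
qed

lemma greater_exists:
  assumes "a \<in> Field \<kappa>"
  obtains b where "b \<in> Field \<kappa>" "a \<in> underS \<kappa> b"
  using infinite_Card_order_limit[OF card_order infinite_Field assms] 
  unfolding underS_def by blast

lemma underS_subset_Field: "underS \<kappa> a \<subseteq> Field \<kappa>"
  by (auto simp: underS_def Field_def)

lemma under_subset_Field: "under \<kappa> a \<subseteq> Field \<kappa>"
  by (auto simp: under_def Field_def)

lemma le_refl: "a \<in> Field \<kappa> \<Longrightarrow> (a, a) \<in> \<kappa>"
  using wo_rel.REFL[OF well_order] by (auto simp: refl_on_def)

lemma le_trans: "(a, b) \<in> \<kappa> \<Longrightarrow> (b, c) \<in> \<kappa> \<Longrightarrow> (a, c) \<in> \<kappa>"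
  using wo_rel.TRANS[OF well_order] by (auto dest: transD)

lemma le_antisym: "(a, b) \<in> \<kappa> \<Longrightarrow> (b, a) \<in> \<kappa> \<Longrightarrow> a = b"
  using wo_rel.ANTISYM[OF well_order] by (auto dest: antisymD)

lemma le_total: "a \<in> Field \<kappa> \<Longrightarrow> b \<in> Field \<kappa> \<Longrightarrow> (a, b) \<in> \<kappa> \<or> (b, a) \<in> \<kappa>"
  using wo_rel.TOTALS[OF well_order] by blast

lemma under_eq_insert: "a \<in> Field \<kappa> \<Longrightarrow> under \<kappa> a = insert a (underS \<kappa> a)"
  using le_refl by (auto simp: under_def underS_def)

lemma underS_trans: "a \<in> underS \<kappa> b \<Longrightarrow> b \<in> underS \<kappa> c \<Longrightarrow> a \<in> underS \<kappa> c"
  using le_trans le_antisym unfolding underS_def by blast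

lemma underS_linear:
  "a \<in> Field \<kappa> \<Longrightarrow> b \<in> Field \<kappa> \<Longrightarrow> a \<in> underS \<kappa> b \<or> a = b \<or> b \<in> underS \<kappa> a"
  using le_total unfolding underS_def by blast

lemma underS_irrefl: "a \<notin> underS \<kappa> a"
  by (simp add: underS_def)

lemma under_mono: "b \<in> under \<kappa> a \<Longrightarrow> under \<kappa> b \<subseteq> under \<kappa> a"
  using le_trans unfolding under_def by blast

lemma underS_mono: "b \<in> under \<kappa> a \<Longrightarrow> underS \<kappa> b \<subseteq> underS \<kappa> a"
  using le_trans le_antisym unfolding under_def underS_def by blast

lemma under_subset_underS: "b \<in> underS \<kappa> a \<Longrightarrow> under \<kappa> b \<subseteq> underS \<kappa> a"
  using le_trans le_antisym unfolding under_def underS_def by blast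

lemma below_induct [consumes 1, case_names step]:
  assumes "a \<in> Field \<kappa>"
    and "\<And>a. a \<in> Field \<kappa> \<Longrightarrow> (\<And>b. b \<in> underS \<kappa> a \<Longrightarrow> P b) \<Longrightarrow> P a"
  shows "P a"
proof -
  have "a \<in> Field \<kappa> \<longrightarrow> P a"
    by (rule wo_rel.well_order_induct[OF well_order])
      (metis assms(2) underS_E underS_subset_Field subsetD)
  then show ?thesis using assms(1) by blast
qed

lemma least_exists:
  assumes "a \<in> Field \<kappa>" "P a"
  obtains m where "m \<in> Field \<kappa>" "P m" "\<And>b. b \<in> underS \<kappa> m \<Longrightarrow> \<not> P b"
proof -
  have "\<exists>m\<in>Field \<kappa>. P m \<and> (\<forall>b\<in>underS \<kappa> m. \<not> P b)"
    using assms by (induction rule: below_induct) (metis underS_subset_Field subsetD)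
  then show ?thesis using that by blast
qed

lemma successor_exists:
  assumes "a \<in> Field \<kappa>"
  obtains b where "b \<in> Field \<kappa>" "underS \<kappa> b = under \<kappa> a"
proof -
  obtain c where "c \<in> Field \<kappa>" "a \<in> underS \<kappa> c" using greater_exists[OF assms] .
  then obtain m where m: "m \<in> Field \<kappa>" "a \<in> underS \<kappa> m" 
    and min: "\<And>b. b \<in> underS \<kappa> m \<Longrightarrow> a \<notin> underS \<kappa> b"
    using least_exists[of c "\<lambda>m. a \<in> underS \<kappa> m"] by blast
  have "underS \<kappa> m = under \<kappa> a"
  proof
    show "underS \<kappa> m \<subseteq> under \<kappa> a"
      using min underS_linear[OF assms] underS_subset_Field under_eq_insert[OF assms] by blast
    show "under \<kappa> a \<subseteq> underS \<kappa> m" by (rule under_subset_underS[OF m(2)])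
  qed
  then show ?thesis using that m by blast
qed

lemma small_bounded:
  assumes "K \<subseteq> Field \<kappa>" "|K| <o \<kappa>"
  obtains a where "a \<in> Field \<kappa>" "K \<subseteq> underS \<kappa> a"
proof -
  have "\<not> cofinal K \<kappa>"
    using regular assms unfolding regularCard_def using not_ordLess_ordIso by blast
  then obtain a where a: "a \<in> Field \<kappa>" "\<And>b. b \<in> K \<Longrightarrow> a = b \<or> (a, b) \<notin> \<kappa>"
    unfolding cofinal_def by blast
  obtain c where c: "c \<in> Field \<kappa>" "a \<in> underS \<kappa> c" using greater_exists[OF a(1)] .
  have "K \<subseteq> under \<kappa> a"
    using a assms(1) le_total le_refl unfolding under_def by blast
  then show ?thesis using that c under_subset_underS by blast
qed

lemma segment_downward_closed: "wo_rel.ofilter \<kappa> D \<Longrightarrow> a \<in> D \<Longrightarrow> under \<kappa> a \<subseteq> D"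
  by (simp add: wo_rel.ofilter_def[OF well_order])

lemma segment_subset_Field: "wo_rel.ofilter \<kappa> D \<Longrightarrow> D \<subseteq> Field \<kappa>"
  by (simp add: wo_rel.ofilter_def[OF well_order])

lemma segment_cases:
  assumes "wo_rel.ofilter \<kappa> D"
  obtains "D = {}" | a where "a \<in> D" "D = under \<kappa> a" | "limit_segment \<kappa> D"
proof (cases "D = {} \<or> limit_segment \<kappa> D")
  case False
  then obtain a where a: "a \<in> D" "\<And>b. b \<in> D \<Longrightarrow> a \<notin> underS \<kappa> b"
    using assms unfolding limit_segment_def by blast
  then have "D = under \<kappa> a"
    using segment_downward_closed[OF assms] segment_subset_Field[OF assms] under_eq_insert underS_linear
    by (smt (verit, best) subsetD subsetI subset_antisym insertCI)
  then show ?thesis using that(2) a(1) by blast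
qed (use that in blast)

lemma ofilter_underS: "wo_rel.ofilter \<kappa> (underS \<kappa> a)"
  by (rule wo_rel.underS_ofilter[OF well_order])

lemma ofilter_under: "wo_rel.ofilter \<kappa> (under \<kappa> a)"
  by (rule wo_rel.under_ofilter[OF well_order])

lemma ofilter_Field: "wo_rel.ofilter \<kappa> (Field \<kappa>)"
  by (rule wo_rel.Field_ofilter[OF well_order])

lemma small_underS: "a \<in> Field \<kappa> \<Longrightarrow> |underS \<kappa> a| <o \<kappa>"
  by (rule card_of_underS[OF card_order])

lemma small_image: "|I| <o \<kappa> \<Longrightarrow> |f ` I| <o \<kappa>"
  using card_of_image ordLeq_ordLess_trans by blast

lemma small_subset: "|I| <o \<kappa> \<Longrightarrow> J \<subseteq> I \<Longrightarrow> |J| <o \<kappa>"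
  using card_of_mono1 ordLeq_ordLess_trans by blast

lemma small_finite: "finite I \<Longrightarrow> |I| <o \<kappa>"
  using ordLess_transitive[OF _ uncountable] finite_iff_ordLess_natLeq by blast

lemma small_countable: "|range (f :: nat \<Rightarrow> 'b)| <o \<kappa>"
  using ordLeq_ordLess_trans[OF ordLeq_ordIso_trans[OF card_of_image[of f UNIV] card_of_nat] uncountable] .

lemma card_Field: "|Field \<kappa>| =o \<kappa>"
  by (rule card_of_Field_ordIso[OF card_order])

section \<open>Additive spaces, clopen bases and partitions\<close>

lemma additive_INT:
  assumes "additive_space \<kappa> X" "|I| <o \<kappa>" "\<And>i. i \<in> I \<Longrightarrow> openin X (U i)"
  shows "openin X (topspace X \<inter> (\<Inter>i\<in>I. U i))"
proof -
  have "(\<forall>V\<in>U ` I. openin X V) \<and> |U ` I| <o \<kappa>"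
    using assms(3) small_image[OF assms(2)] by blast
  then show ?thesis using assms(1) unfolding additive_space_def by blast
qed

lemma additive_INT_in_open:
  assumes "additive_space \<kappa> X" "|I| <o \<kappa>" "\<And>i. i \<in> I \<Longrightarrow> openin X (U i)" "openin X C"
  shows "openin X (C \<inter> (\<Inter>i\<in>I. U i))"
proof -
  have "C \<inter> (\<Inter>i\<in>I. U i) = C \<inter> (topspace X \<inter> (\<Inter>i\<in>I. U i))"
    using openin_subset[OF assms(4)] by blast
  then show ?thesis using additive_INT[OF assms(1-3)] assms(4) by (simp add: openin_Int)
qed

lemma perfect_iff_kappa_perfect:
  assumes "additive_space \<kappa> X"
  shows "perfect_space X \<longleftrightarrow> kappa_perfect_space \<kappa> X"
proof
  assume "perfect_space X"
  then show "kappa_perfect_space \<kappa> X"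
    using assms unfolding perfect_space_def kappa_perfect_space_def additive_space_def by fastforce
next
  assume *: "kappa_perfect_space \<kappa> X"
  show "perfect_space X"
    unfolding perfect_space_def
  proof (intro ballI notI)
    fix x assume "x \<in> topspace X" "openin X {x}"
    moreover have "|{{x}}| <o \<kappa>" by (rule small_finite) simp
    moreover have "topspace X \<inter> \<Inter>{{x}} = {x}" using \<open>x \<in> topspace X\<close> by auto
    ultimately show False
      using * unfolding kappa_perfect_space_def by (metis singletonD)
  qed
qed

text \<open>
  Dependent choice of length \<open>\<kappa>\<close>: the value at \<open>a\<close> may be constrained by all earlier values.
\<close>

lemma transfinite_choice:
  assumes adm: "\<And>f g a v. a \<in> Field \<kappa> \<Longrightarrow> (\<And>b. b \<in> underS \<kappa> a \<Longrightarrow> f b = g b) \<Longrightarrow> P f a v \<longleftrightarrow> P g a v"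
    and step: "\<And>f a. a \<in> Field \<kappa> \<Longrightarrow> (\<And>b. b \<in> underS \<kappa> a \<Longrightarrow> P f b (f b)) \<Longrightarrow> \<exists>v. P f a v"
  obtains f where "\<And>a. a \<in> Field \<kappa> \<Longrightarrow> P f a (f a)"
proof -
  have *: "(b, a) \<in> \<kappa> - Id \<longleftrightarrow> b \<in> underS \<kappa> a" for a b
    by (auto simp: underS_def)
  have "\<exists>f. \<forall>a. a \<in> Field \<kappa> \<longrightarrow> P f a (f a)"
  proof (rule dependent_wf_choice[of "\<kappa> - Id" "\<lambda>f a v. a \<in> Field \<kappa> \<longrightarrow> P f a v"])
    show "wf (\<kappa> - Id)" by (rule wo_rel.WF[OF well_order])
    show "(a \<in> Field \<kappa> \<longrightarrow> P f a v) = (a \<in> Field \<kappa> \<longrightarrow> P g a v)"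
      if "\<And>b. (b, a) \<in> \<kappa> - Id \<Longrightarrow> f b = g b" for f g a v
      using adm[of a f g v] that unfolding * by blast
    show "\<exists>v. a \<in> Field \<kappa> \<longrightarrow> P f a v"
      if "\<And>b. (b, a) \<in> \<kappa> - Id \<Longrightarrow> b \<in> Field \<kappa> \<longrightarrow> P f b (f b)" for f a
      using step[of a f] that underS_subset_Field unfolding * by blast
  qed
  then show ?thesis using that by blast
qed

text \<open>
  Regularity gives a decreasing sequence of open sets \<open>G n\<close> interleaved with closed sets
  \<open>C n\<close>. Both sequences have the same intersection; it is closed, and it is open because
  \<open>\<kappa>\<close> is uncountable, so that a countable intersection of open sets is open.
\<close>

lemma zero_dimensional:
  assumes "regular_space X" "additive_space \<kappa> X" "openin X U" "x \<in> U"
  obtains W where "openin X W" "closedin X W" "x \<in> W" "W \<subseteq> U"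
proof -
  have nb: "\<exists>V C. openin X V \<and> closedin X C \<and> x \<in> V \<and> V \<subseteq> C \<and> C \<subseteq> G"
    if "openin X G" "x \<in> G" for G
    using assms(1) that unfolding neighbourhood_base_of_closedin[symmetric] neighbourhood_base_of
    by blast
  let ?P = "\<lambda>(n::nat) G. openin X G \<and> x \<in> G \<and> G \<subseteq> U"
  let ?Q = "\<lambda>(n::nat) G G'. \<exists>C. closedin X C \<and> G' \<subseteq> C \<and> C \<subseteq> G"
  have "\<exists>G. \<forall>n. ?P n (G n) \<and> ?Q n (G n) (G (Suc n))"
  proof (rule dependent_nat_choice)
    show "\<exists>G. ?P 0 G" using assms(3,4) by blast
    fix G n assume G: "?P n G"
    then obtain V C where "openin X V" "closedin X C" "x \<in> V" "V \<subseteq> C" "C \<subseteq> G"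
      using nb[of G] by blast
    then show "\<exists>G'. ?P (Suc n) G' \<and> ?Q n G G'" using G by blast
  qed
  then obtain G where *: "\<forall>n. ?P n (G n) \<and> ?Q n (G n) (G (Suc n))" ..
  then have G: "\<And>n. openin X (G n) \<and> x \<in> G n \<and> G n \<subseteq> U"
    and shrink: "\<forall>n. \<exists>C. closedin X C \<and> G (Suc n) \<subseteq> C \<and> C \<subseteq> G n"
    by simp_all
  obtain C where C: "\<And>n. closedin X (C n)" "\<And>n. G (Suc n) \<subseteq> C n" "\<And>n. C n \<subseteq> G n"
    using choice[OF shrink] by blast
  define W where "W = (\<Inter>n. G n)"
  have W: "W = (\<Inter>n. C n)"
    using C(2,3) unfolding W_def by blast
  have "openin X (U \<inter> (\<Inter>i\<in>range (\<lambda>n::nat. n). G i))"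
    by (rule additive_INT_in_open[OF assms(2) small_countable]) (use G assms(3) in auto)
  moreover have "U \<inter> (\<Inter>i\<in>range (\<lambda>n::nat. n). G i) = W"
    using G unfolding W_def by auto
  ultimately have "openin X W" by simp
  moreover have "closedin X W"
    unfolding W using C(1) by blast
  ultimately show ?thesis using that G unfolding W_def by blast
qed

text \<open>
  The base is indexed by all of \<open>\<kappa>\<close>, possibly with repetitions, so that its members can be
  treated one at a time along the ordinals below \<open>\<kappa>\<close>.
\<close>

definition clopen_base :: "'a topology \<Rightarrow> ('k \<Rightarrow> 'a set) \<Rightarrow> bool" where
  "clopen_base X B \<longleftrightarrow>
     (\<forall>a. openin X (B a) \<and> closedin X (B a)) \<and>
     (\<forall>U x. openin X U \<and> x \<in> U \<longrightarrow> (\<exists>a\<in>Field \<kappa>. x \<in> B a \<and> B a \<subseteq> U))"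

lemma clopen_base_exists:
  assumes "regular_space X" "additive_space \<kappa> X" "weight_le X \<kappa>"
  obtains B where "clopen_base X B"
proof -
  obtain \<B> where *: "|\<B>| \<le>o \<kappa> \<and> (\<forall>V\<in>\<B>. openin X V) \<and>
      (\<forall>U x. openin X U \<and> x \<in> U \<longrightarrow> (\<exists>V\<in>\<B>. x \<in> V \<and> V \<subseteq> U))"
    using assms(3) unfolding weight_le_def ..
  then have \<B>: "|\<B>| \<le>o \<kappa>" "\<forall>V\<in>\<B>. openin X V"
    and base: "\<And>U x. openin X U \<Longrightarrow> x \<in> U \<Longrightarrow> \<exists>V\<in>\<B>. x \<in> V \<and> V \<subseteq> U"
    by simp_all
  define P where "P p W \<longleftrightarrow> openin X W \<and> closedin X W \<and> fst p \<subseteq> W \<and> W \<subseteq> snd p" for p W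
  define w where "w p = (if \<exists>W. P p W then SOME W. P p W else {})" for p
  define \<W> where "\<W> = insert {} (w ` (\<B> \<times> \<B>))"
  have clopen: "openin X (w p) \<and> closedin X (w p)" for p
  proof (cases "\<exists>W. P p W")
    case True
    then have "P p (w p)" unfolding w_def by (simp add: someI_ex)
    then show ?thesis by (simp add: P_def)
  qed (simp add: w_def)
  have "|\<B> \<times> \<B>| \<le>o \<kappa>"
    by (rule card_of_Times_ordLeq_infinite_Field[OF infinite_Field \<B>(1) \<B>(1) card_order])
  then have "|w ` (\<B> \<times> \<B>)| \<le>o \<kappa>" by (rule ordLeq_transitive[OF card_of_image])
  moreover have "|{{}} :: 'a set set| \<le>o \<kappa>"
    by (rule ordLess_imp_ordLeq, rule small_finite) simp
  ultimately have "|{{}} \<union> w ` (\<B> \<times> \<B>)| \<le>o \<kappa>"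
    using card_of_Un_ordLeq_infinite_Field[OF infinite_Field _ _ card_order] by blast
  then have "|\<W>| \<le>o |Field \<kappa>|"
    using ordLeq_ordIso_trans[OF _ ordIso_symmetric[OF card_Field]] unfolding \<W>_def by auto
  moreover have "\<W> \<noteq> {}" by (simp add: \<W>_def)
  ultimately obtain B where B: "B ` Field \<kappa> = \<W>"
    using card_of_ordLeq2[of \<W> "Field \<kappa>"] by auto
  have "\<exists>a\<in>Field \<kappa>. x \<in> B a \<and> B a \<subseteq> U" if U: "openin X U" "x \<in> U" for U x
  proof -
    obtain V where V: "V \<in> \<B>" "x \<in> V" "V \<subseteq> U" using base U by blast
    obtain W where W: "openin X W" "closedin X W" "x \<in> W" "W \<subseteq> V"
      using zero_dimensional[OF assms(1,2)] V(1,2) \<B>(2) by blast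
    obtain V' where V': "V' \<in> \<B>" "x \<in> V'" "V' \<subseteq> W" using base W by blast
    have "P (V', V) W" using W V' by (simp add: P_def)
    then have "P (V', V) (w (V', V))" unfolding w_def by (metis someI)
    then have "x \<in> w (V', V)" "w (V', V) \<subseteq> U" using V V' by (auto simp: P_def)
    moreover have "w (V', V) \<in> B ` Field \<kappa>" unfolding B \<W>_def using V V' by blast
    ultimately show ?thesis by auto
  qed
  moreover have "openin X (B a) \<and> closedin X (B a)" if "a \<in> Field \<kappa>" for a
  proof -
    have "B a \<in> \<W>" using B that by blast
    then show ?thesis using clopen unfolding \<W>_def by auto
  qed
  ultimately have "clopen_base X (\<lambda>a. if a \<in> Field \<kappa> then B a else {})"
    unfolding clopen_base_def by auto
  then show ?thesis using that by blast
qed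

definition locally_constant_on :: "'a topology \<Rightarrow> 'a set \<Rightarrow> ('a \<Rightarrow> 'b) \<Rightarrow> bool" where
  "locally_constant_on X C l \<longleftrightarrow>
     (\<forall>x\<in>C. \<exists>U. openin X U \<and> x \<in> U \<and> U \<subseteq> C \<and> (\<forall>y\<in>U. l y = l x))"

lemma locally_constant_on_compose:
  "locally_constant_on X C l \<Longrightarrow> locally_constant_on X C (\<lambda>x. h (l x))"
  unfolding locally_constant_on_def by metis

lemma locally_constant_on_fibre:
  assumes "locally_constant_on X C l"
  shows "openin X {y \<in> C. l y = c}"
proof (subst openin_subopen, intro ballI)
  fix x assume x: "x \<in> {y \<in> C. l y = c}"
  then have "x \<in> C" by simp
  then obtain U where U: "openin X U" "x \<in> U" "U \<subseteq> C" "\<forall>y\<in>U. l y = l x"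
    using assms unfolding locally_constant_on_def by blast
  have "l y = c" if "y \<in> U" for y using bspec[OF U(4) that] x by simp
  then show "\<exists>T. openin X T \<and> x \<in> T \<and> T \<subseteq> {y \<in> C. l y = c}"
    using U(1-3) by (intro exI[of _ U]) blast
qed

lemma locally_constant_on_fibrewise:
  assumes "\<And>x. x \<in> C \<Longrightarrow> openin X {y \<in> C. l y = l x}"
  shows "locally_constant_on X C l"
  using assms unfolding locally_constant_on_def by fastforce

text \<open>
  Partitions are encoded by their index functions: a locally constant function on \<open>C\<close> with
  image \<open>K\<close> is a partition of \<open>C\<close> into nonempty open pieces indexed by \<open>K\<close>.
\<close>

definition splits_onto :: "'a topology \<Rightarrow> 'b set \<Rightarrow> bool" where
  "splits_onto X K \<longleftrightarrow>
     (\<forall>C. openin X C \<and> C \<noteq> {} \<longrightarrow> (\<exists>l. locally_constant_on X C l \<and> l ` C = K))"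

text \<open>
  A point \<open>y\<close> is indexed by the first base set that contains \<open>y\<close> and lies in some \<open>N x\<close>. The
  pieces are open since each removes from a base set only fewer than \<open>\<kappa>\<close> earlier clopen
  ones. The function \<open>q\<close> remembers, for each piece, a point whose neighbourhood contains the
  piece; this point need not lie in the piece. If there are \<open>\<kappa>\<close> pieces, they are reindexed
  so that every ordinal below \<open>\<kappa>\<close> is an index: later this makes codes surjective.
\<close>

lemma disjoint_refinement:
  assumes add: "additive_space \<kappa> X" and base: "clopen_base X B" and C: "openin X C"
    and N: "\<And>x. x \<in> C \<Longrightarrow> openin X (N x) \<and> x \<in> N x"
  obtains i q where "locally_constant_on X C i" "i ` C \<subseteq> Field \<kappa>"
    "|Field \<kappa>| \<le>o |i ` C| \<Longrightarrow> i ` C = Field \<kappa>"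
    "\<And>x. x \<in> C \<Longrightarrow> q (i x) \<in> C" "\<And>x. x \<in> C \<Longrightarrow> x \<in> N (q (i x))"
proof -
  define good where "good a \<longleftrightarrow> a \<in> Field \<kappa> \<and> (\<exists>x\<in>C. B a \<subseteq> N x)" for a
  define q where "q a = (SOME x. x \<in> C \<and> B a \<subseteq> N x)" for a
  have q: "q a \<in> C \<and> B a \<subseteq> N (q a)" if "good a" for a
    using that someI_ex[of "\<lambda>x. x \<in> C \<and> B a \<subseteq> N x"] unfolding good_def q_def by blast
  have "\<exists>a. good a \<and> y \<in> B a \<and> (\<forall>b\<in>underS \<kappa> a. \<not> (good b \<and> y \<in> B b))" if y: "y \<in> C" for y
  proof -
    obtain a where "a \<in> Field \<kappa>" "y \<in> B a" "B a \<subseteq> N y"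
      using base N[OF y] unfolding clopen_base_def by blast
    then have "a \<in> Field \<kappa>" "good a \<and> y \<in> B a" using y unfolding good_def by blast+
    then obtain m where "m \<in> Field \<kappa>" "good m \<and> y \<in> B m"
      "\<And>b. b \<in> underS \<kappa> m \<Longrightarrow> \<not> (good b \<and> y \<in> B b)"
      using least_exists[of a "\<lambda>m. good m \<and> y \<in> B m"] by blast
    then show ?thesis by blast
  qed
  then obtain i where i: "\<And>y. y \<in> C \<Longrightarrow> good (i y)" "\<And>y. y \<in> C \<Longrightarrow> y \<in> B (i y)"
    and least: "\<And>y b. y \<in> C \<Longrightarrow> b \<in> underS \<kappa> (i y) \<Longrightarrow> \<not> (good b \<and> y \<in> B b)"
    by metis
  have i_Field: "i y \<in> Field \<kappa>" if "y \<in> C" for y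
    using i(1)[OF that] by (simp add: good_def)
  have lc: "locally_constant_on X C i"
    unfolding locally_constant_on_def
  proof
    fix y assume y: "y \<in> C"
    define J where "J = {b \<in> underS \<kappa> (i y). good b}"
    define U where "U = (C \<inter> B (i y)) \<inter> (\<Inter>b\<in>J. topspace X - B b)"
    have "|J| <o \<kappa>"
      by (rule small_subset[OF small_underS[OF i_Field[OF y]]]) (simp add: J_def)
    moreover have "openin X (C \<inter> B (i y))" "\<And>b. openin X (topspace X - B b)"
      using base C unfolding clopen_base_def by blast+
    ultimately have "openin X U"
      unfolding U_def by (intro additive_INT_in_open[OF add])
    moreover have "y \<in> U"
      using y i(2) least[OF y] openin_subset[OF C] unfolding U_def J_def by blast
    moreover have "i z = i y" if "z \<in> U" for z
    proof -
      have z: "z \<in> C" "z \<in> B (i y)" "\<And>b. b \<in> J \<Longrightarrow> z \<notin> B b"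
        using that unfolding U_def by blast+
      have "i z \<notin> underS \<kappa> (i y)" using z(3) i[OF z(1)] unfolding J_def by blast
      moreover have "i y \<notin> underS \<kappa> (i z)" using least[OF z(1)] z(2) i(1)[OF y] by blast
      ultimately show ?thesis using underS_linear i_Field[OF y] i_Field[OF z(1)] by blast
    qed
    ultimately show "\<exists>U. openin X U \<and> y \<in> U \<and> U \<subseteq> C \<and> (\<forall>z\<in>U. i z = i y)"
      unfolding U_def by blast
  qed
  show ?thesis
  proof (cases "|Field \<kappa>| \<le>o |i ` C|")
    case True
    have "i ` C \<subseteq> Field \<kappa>" using i_Field by blast
    then have "|i ` C| =o |Field \<kappa>|" using True card_of_mono1 ordIso_iff_ordLeq by blast
    then obtain h where h: "bij_betw h (i ` C) (Field \<kappa>)" using card_of_ordIso by blast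
    show ?thesis
    proof (rule that[of "\<lambda>y. h (i y)" "\<lambda>a. q (inv_into (i ` C) h a)"])
      show "locally_constant_on X C (\<lambda>y. h (i y))" by (rule locally_constant_on_compose[OF lc])
      show "(\<lambda>y. h (i y)) ` C \<subseteq> Field \<kappa>" "(\<lambda>y. h (i y)) ` C = Field \<kappa>"
        using h unfolding bij_betw_def by auto
      have inv: "inv_into (i ` C) h (h (i x)) = i x" if "x \<in> C" for x
        using h that unfolding bij_betw_def by (simp add: inv_into_f_f)
      show "q (inv_into (i ` C) h (h (i x))) \<in> C" if "x \<in> C" for x
        using inv[OF that] q[OF i(1)[OF that]] by simp
      show "x \<in> N (q (inv_into (i ` C) h (h (i x))))" if "x \<in> C" for x
        using inv[OF that] q[OF i(1)[OF that]] i(2)[OF that] by auto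
    qed
  next
    case False
    show ?thesis by (rule that[of i q]) (use lc i_Field q i False in blast)+
  qed
qed

text \<open>
  A nonempty open set \<open>C\<close> of a perfect additive space has at least \<open>\<kappa>\<close> points, since otherwise
  its points would be isolated. For the same reason a copy \<open>j ` K\<close> of \<open>K\<close> inside \<open>C\<close> is closed and
  discrete, so \<open>C\<close> is covered by open sets that each contain at most one point of \<open>j ` K\<close>. A
  refining partition separates the points of \<open>j ` K\<close>.
\<close>

lemma small_splits:
  fixes K :: "'b set"
  assumes add: "additive_space \<kappa> X" and base: "clopen_base X B" and haus: "Hausdorff_space X"
    and perf: "perfect_space X" and K: "|K| <o \<kappa>" "K \<noteq> {}"
  shows "splits_onto X K"
  unfolding splits_onto_def
proof (intro allI impI)
  fix C assume C: "openin X C \<and> C \<noteq> {}"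
  have sub: "C \<subseteq> topspace X" using C openin_subset by blast
  have op: "openin X (C \<inter> (\<Inter>y\<in>S. topspace X - {y}))" if "S \<subseteq> C" "|S| <o \<kappa>" for S
  proof (rule additive_INT_in_open[OF add that(2)])
    show "openin X (topspace X - {y})" if "y \<in> S" for y
      using closedin_Hausdorff_singleton[OF haus] that \<open>S \<subseteq> C\<close> sub by blast
  qed (use C in simp)
  have "\<not> |C| \<le>o |K|"
  proof
    assume "|C| \<le>o |K|"
    then have small: "|C| <o \<kappa>" using K(1) ordLeq_ordLess_trans by blast
    obtain x where x: "x \<in> C" using C by blast
    have "openin X (C \<inter> (\<Inter>y\<in>C - {x}. topspace X - {y}))"
      by (rule op) (use small_subset[OF small] in auto)
    moreover have "C \<inter> (\<Inter>y\<in>C - {x}. topspace X - {y}) = {x}" using x sub by auto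
    ultimately show False using perf x sub unfolding perfect_space_def by auto
  qed
  then have "|K| \<le>o |C|" using ordLeq_total[OF card_of_Well_order card_of_Well_order] by blast
  then obtain j where j: "inj_on j K" "j ` K \<subseteq> C" unfolding card_of_ordLeq[symmetric] by auto
  \<comment> \<open>A neighbourhood of \<open>x\<close> that contains no point of \<open>j ` K\<close> except possibly \<open>x\<close>.\<close>
  define N where "N x = C \<inter> (\<Inter>y\<in>j ` K - {x}. topspace X - {y})" for x
  have N: "openin X (N x) \<and> x \<in> N x" if "x \<in> C" for x
  proof -
    have "|j ` K - {x}| <o \<kappa>" by (rule small_subset[OF small_image[OF K(1)]]) blast
    then have "openin X (N x)" unfolding N_def by (intro op) (use j(2) in blast)
    then show ?thesis using that sub unfolding N_def by blast
  qed
  obtain i :: "_ \<Rightarrow> 'k" and q where i: "locally_constant_on X C i"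
    and q: "\<And>x. x \<in> C \<Longrightarrow> q (i x) \<in> C" "\<And>x. x \<in> C \<Longrightarrow> x \<in> N (q (i x))"
    by (rule disjoint_refinement[OF add base, of C N]) (use C N in blast)+
  have inj: "inj_on (\<lambda>a. i (j a)) K"
  proof (rule inj_onI)
    fix a b assume ab: "a \<in> K" "b \<in> K" "i (j a) = i (j b)"
    then have "j a \<in> N (q (i (j a)))" "j b \<in> N (q (i (j a)))" using q(2) j(2) by fastforce+
    then have "j a = q (i (j a))" "j b = q (i (j a))" using ab unfolding N_def by blast+
    then show "a = b" using j(1) ab by (metis inj_onD)
  qed
  obtain k where k: "k \<in> K" using K(2) by blast
  define h where "h c = (if c \<in> (\<lambda>a. i (j a)) ` K then inv_into K (\<lambda>a. i (j a)) c else k)" for c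
  have "locally_constant_on X C (\<lambda>x. h (i x))" by (rule locally_constant_on_compose[OF i])
  moreover have "(\<lambda>x. h (i x)) ` C = K"
  proof
    show "(\<lambda>x. h (i x)) ` C \<subseteq> K"
      using k by (auto simp: h_def intro: inv_into_into)
    have "h (i (j a)) = a" if "a \<in> K" for a
      using inv_into_f_f[OF inj that] that by (simp add: h_def)
    then have "K = (\<lambda>x. h (i x)) ` j ` K" by (simp add: image_image)
    then show "K \<subseteq> (\<lambda>x. h (i x)) ` C" using image_mono[OF j(2), of "\<lambda>x. h (i x)"] by simp
  qed
  ultimately show "\<exists>l. locally_constant_on X C l \<and> l ` C = K" by blast
qed

end

text \<open>
  This yields the weight of the generalized Baire space from that of the Cantor space, in place
  of a computation of the number of bounded sequences of ordinals below \<open>\<kappa>\<close>.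
\<close>

lemma weight_le_homeomorphic:
  assumes "X homeomorphic_space Y" "weight_le X \<kappa>"
  shows "weight_le Y \<kappa>"
proof -
  obtain f g where fg: "homeomorphic_maps X Y f g"
    using assms(1) unfolding homeomorphic_space_def by blast
  have f: "homeomorphic_map X Y f"
    using fg homeomorphic_maps_map by blast
  have inv: "\<And>y. y \<in> topspace Y \<Longrightarrow> f (g y) = y"
    and cont: "continuous_map Y X g"
    using fg unfolding homeomorphic_maps_def by blast+
  obtain \<B> where "|\<B>| \<le>o \<kappa> \<and> (\<forall>V\<in>\<B>. openin X V) \<and>
      (\<forall>U x. openin X U \<and> x \<in> U \<longrightarrow> (\<exists>V\<in>\<B>. x \<in> V \<and> V \<subseteq> U))"
    using assms(2) unfolding weight_le_def ..
  then have \<B>: "|\<B>| \<le>o \<kappa>" "\<And>V. V \<in> \<B> \<Longrightarrow> openin X V"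
    and base: "\<And>U x. openin X U \<Longrightarrow> x \<in> U \<Longrightarrow> \<exists>V\<in>\<B>. x \<in> V \<and> V \<subseteq> U"
    by simp_all
  have "|(`) f ` \<B>| \<le>o \<kappa>" by (rule ordLeq_transitive[OF card_of_image \<B>(1)])
  moreover have "\<forall>V\<in>(`) f ` \<B>. openin Y V"
    using \<B>(2) homeomorphic_map_openness[OF f] openin_subset by blast
  moreover have "\<exists>V\<in>(`) f ` \<B>. y \<in> V \<and> V \<subseteq> U" if U: "openin Y U" "y \<in> U" for U y
  proof -
    have UY: "U \<subseteq> topspace Y" by (rule openin_subset[OF U(1)])
    have gY: "g y \<in> topspace X"
      using continuous_map_image_subset_topspace[OF cont] U(2) UY by blast
    let ?W = "{x \<in> topspace X. f x \<in> U}"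
    have "openin X ?W"
      using fg U(1) unfolding homeomorphic_maps_def continuous_map_def by blast
    moreover have "g y \<in> ?W" using gY U(2) UY inv by auto
    ultimately obtain V where V: "V \<in> \<B>" "g y \<in> V" "V \<subseteq> ?W" using base by blast
    have "y = f (g y)" using inv U(2) UY by auto
    then have "y \<in> f ` V" using V(2) by (rule image_eqI)
    then show ?thesis using V(1,3) by (intro bexI[of _ "f ` V"]) auto
  qed
  ultimately show ?thesis unfolding weight_le_def by (intro exI[of _ "(`) f ` \<B>"]) simp
qed

section \<open>Coding points by sequences of cells\<close>

text \<open>
  The points of the open set \<open>A\<close> are coded by index sequences: \<open>f a x\<close> is the index, at level \<open>a\<close>,
  of the piece that contains \<open>x\<close> when the cell of all points with the same earlier indices is
  partitioned. Cells are open and form neighbourhood bases, and an index sequence of limit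
  length that is realised up to each of its levels is realised as a whole; this is the trace
  of the Choquet game. A coarser colouring \<open>l\<close> of the pieces takes prescribed values: in a cell
  with label history \<open>s\<close> at level \<open>a\<close>, the labels are exactly the elements of \<open>K a s\<close>.
  Labels are separate from indices because a partition that refines the answers of II's strategy
  cannot be expected to have a prescribed number of pieces.
\<close>

locale tree_coding = regular_uncountable \<kappa> for \<kappa> :: "'k rel" +
  fixes X :: "'a topology" and A :: "'a set" and K :: "'k \<Rightarrow> ('k \<Rightarrow> 'l) \<Rightarrow> 'l set"
    and f :: "'k \<Rightarrow> 'a \<Rightarrow> 'k" and l :: "'k \<Rightarrow> 'a \<Rightarrow> 'l"
  assumes K_local: "a \<in> Field \<kappa> \<Longrightarrow> (\<And>b. b \<in> underS \<kappa> a \<Longrightarrow> s b = s' b) \<Longrightarrow> K a s = K a s'"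
    and index_in_Field: "a \<in> Field \<kappa> \<Longrightarrow> x \<in> A \<Longrightarrow> f a x \<in> Field \<kappa>"
    and cell_open: "a \<in> Field \<kappa> \<Longrightarrow> x \<in> A \<Longrightarrow> openin X {y \<in> A. \<forall>b\<in>underS \<kappa> a. f b y = f b x}"
    and cell_base: "x \<in> A \<Longrightarrow> openin X U \<Longrightarrow> x \<in> U \<Longrightarrow>
      \<exists>a\<in>Field \<kappa>. \<forall>y\<in>A. (\<forall>b\<in>underS \<kappa> a. f b y = f b x) \<longrightarrow> y \<in> U"
    and label_determined: "a \<in> Field \<kappa> \<Longrightarrow> x \<in> A \<Longrightarrow> y \<in> A \<Longrightarrow>
      (\<And>b. b \<in> under \<kappa> a \<Longrightarrow> f b y = f b x) \<Longrightarrow> l a y = l a x"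
    and labels_of_cell: "a \<in> Field \<kappa> \<Longrightarrow> x \<in> A \<Longrightarrow>
      l a ` {y \<in> A. \<forall>b\<in>underS \<kappa> a. f b y = f b x} = K a (\<lambda>b. l b x)"
    and index_full: "a \<in> Field \<kappa> \<Longrightarrow> x \<in> A \<Longrightarrow>
      |Field \<kappa>| \<le>o |f a ` {y \<in> A. \<forall>b\<in>underS \<kappa> a. f b y = f b x}| \<Longrightarrow>
      f a ` {y \<in> A. \<forall>b\<in>underS \<kappa> a. f b y = f b x} = Field \<kappa>"
    and limit_realized: "limit_segment \<kappa> D \<Longrightarrow>
      (\<And>a. a \<in> D \<Longrightarrow> \<exists>x\<in>A. \<forall>b\<in>under \<kappa> a. f b x = z b) \<Longrightarrow> \<exists>x\<in>A. \<forall>b\<in>D. f b x = z b"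

text \<open>
  The answers of II depend only on the moves of I up to the current round, so runs may be
  altered freely at later rounds.
\<close>

lemma response_cong:
  "(\<And>b. b \<in> under \<kappa> a \<Longrightarrow> p b = p' b) \<Longrightarrow> response \<kappa> \<sigma> p a = response \<kappa> \<sigma> p' a"
  unfolding response_def by (metis restrict_ext)

locale choquet_scheme = regular_uncountable \<kappa> for \<kappa> :: "'k rel" +
  fixes X :: "'a topology" and B :: "'k \<Rightarrow> 'a set" and \<sigma> :: "('k, 'a) strategy_II"
    and A :: "'a set" and K :: "'k \<Rightarrow> ('k \<Rightarrow> 'l) \<Rightarrow> 'l set"
  assumes additive: "additive_space \<kappa> X" and base: "clopen_base X B"
    and winning: "winning_strategy_II \<kappa> X \<sigma>" and open_A: "openin X A"
    and K_local: "a \<in> Field \<kappa> \<Longrightarrow> (\<And>b. b \<in> underS \<kappa> a \<Longrightarrow> s b = s' b) \<Longrightarrow> K a s = K a s'"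
    and K_splits: "a \<in> Field \<kappa> \<Longrightarrow> splits_onto X (K a s)"
begin

text \<open>
  One step of the construction. In the cell \<open>C\<close> at level \<open>a\<close>, the value \<open>v x = (i, c, q)\<close> consists
  of the index \<open>i\<close> of the piece containing \<open>x\<close>, its label \<open>c\<close>, and the point \<open>q\<close> that I plays
  together with \<open>C\<close> in round \<open>a\<close>. The piece has to lie in the answer of II to that move,
  \<open>p\<close> being the earlier part of the run, and it has to lie inside \<open>B a\<close> or outside it, which makes
  the cells neighbourhood bases in the end.
\<close>

definition cell_ok ::
    "'k \<Rightarrow> 'a set \<Rightarrow> ('k \<Rightarrow> 'a set \<times> 'a) \<Rightarrow> 'l set \<Rightarrow> ('a \<Rightarrow> 'k \<times> 'l \<times> 'a) \<Rightarrow> bool" where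
  "cell_ok a C p L v \<longleftrightarrow>
     (\<forall>x\<in>C. openin X {y \<in> C. fst (v y) = fst (v x)} \<and> snd (snd (v x)) \<in> C \<and>
        (\<forall>y\<in>C. fst (v y) = fst (v x) \<longrightarrow>
           v y = v x \<and> (y \<in> B a \<longleftrightarrow> x \<in> B a) \<and>
           y \<in> response \<kappa> \<sigma> (p(a := (C, snd (snd (v x))))) a)) \<and>
     (\<lambda>y. fst (snd (v y))) ` C = L \<and> (\<lambda>y. fst (v y)) ` C \<subseteq> Field \<kappa> \<and>
     ( |Field \<kappa>| \<le>o |(\<lambda>y. fst (v y)) ` C| \<longrightarrow> (\<lambda>y. fst (v y)) ` C = Field \<kappa>)"

lemma cell_okD:
  assumes "cell_ok a C p L v" "x \<in> C"
  shows "openin X {y \<in> C. fst (v y) = fst (v x)}" "snd (snd (v x)) \<in> C"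
    and "y \<in> C \<Longrightarrow> fst (v y) = fst (v x) \<Longrightarrow> v y = v x"
    and "y \<in> C \<Longrightarrow> fst (v y) = fst (v x) \<Longrightarrow> y \<in> B a \<longleftrightarrow> x \<in> B a"
    and "y \<in> C \<Longrightarrow> fst (v y) = fst (v x) \<Longrightarrow>
      y \<in> response \<kappa> \<sigma> (p(a := (C, snd (snd (v x))))) a"
    and "fst (v x) \<in> Field \<kappa>"
  using assms unfolding cell_ok_def by blast+

lemma cell_ok_cong:
  assumes a: "a \<in> Field \<kappa>" and p: "\<And>b. b \<in> underS \<kappa> a \<Longrightarrow> p b = p' b"
    and v: "\<And>y. y \<in> C \<Longrightarrow> v y = v' y" and ok: "cell_ok a C p L v"
  shows "cell_ok a C p' L v'"
proof -
  have r: "response \<kappa> \<sigma> (p(a := q)) a = response \<kappa> \<sigma> (p'(a := q)) a" for q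
    by (rule response_cong) (use p under_eq_insert[OF a] in auto)
  have img: "(\<lambda>y. fst (snd (v' y))) ` C = (\<lambda>y. fst (snd (v y))) ` C"
    "(\<lambda>y. fst (v' y)) ` C = (\<lambda>y. fst (v y)) ` C"
    using v by (auto intro!: image_cong)
  show ?thesis
    unfolding cell_ok_def img
  proof (intro conjI ballI impI)
    fix x assume x: "x \<in> C"
    have "{y \<in> C. fst (v' y) = fst (v' x)} = {y \<in> C. fst (v y) = fst (v x)}"
      using v x by auto
    then show "openin X {y \<in> C. fst (v' y) = fst (v' x)}" using cell_okD(1)[OF ok x] by simp
    show "snd (snd (v' x)) \<in> C" using cell_okD(2)[OF ok x] v[OF x] by simp
    fix y assume y: "y \<in> C" and "fst (v' y) = fst (v' x)"
    then have eq: "fst (v y) = fst (v x)" using v[OF x] v[OF y] by simp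
    show "v' y = v' x" using cell_okD(3)[OF ok x y eq] v[OF x] v[OF y] by simp
    show "y \<in> B a \<longleftrightarrow> x \<in> B a" by (rule cell_okD(4)[OF ok x y eq])
    show "y \<in> response \<kappa> \<sigma> (p'(a := (C, snd (snd (v' x))))) a"
      using cell_okD(5)[OF ok x y eq] v[OF x] unfolding r by simp
  qed (use ok in \<open>simp_all add: cell_ok_def\<close>)
qed

text \<open>
  Each \<open>x\<close> in \<open>C\<close> has a neighbourhood \<open>N x\<close> with the required properties: the answer \<open>R x\<close> of II to the
  move \<open>(C, x)\<close>, cut down so that the label and membership in \<open>B a\<close> are constant. A partition
  that refines these neighbourhoods is as required, the point played for a piece being the one
  whose neighbourhood contains the piece.
\<close>

lemma cell_ok_exists:
  assumes a: "a \<in> Field \<kappa>" and C: "openin X C" "C \<noteq> {}"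
    and region: "C \<subseteq> game_region \<kappa> X (response \<kappa> \<sigma> p) a"
    and legal: "\<And>b. b \<in> underS \<kappa> a \<Longrightarrow> legal_I \<kappa> X p (response \<kappa> \<sigma> p) b"
    and L: "splits_onto X L"
  shows "\<exists>v. cell_ok a C p L v"
proof -
  define R where "R x = response \<kappa> \<sigma> (p(a := (C, x))) a" for x
  have R: "openin X (R x)" "x \<in> R x" "R x \<subseteq> C" if x: "x \<in> C" for x
  proof -
    let ?p = "p(a := (C, x))"
    have below: "response \<kappa> \<sigma> ?p b = response \<kappa> \<sigma> p b" if "b \<in> underS \<kappa> a" for b
      by (rule response_cong) (use under_subset_underS[OF that] underS_irrefl in auto)
    have reg: "game_region \<kappa> X (response \<kappa> \<sigma> ?p) b = game_region \<kappa> X (response \<kappa> \<sigma> p) b"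
      if "b \<in> under \<kappa> a" for b
      using below underS_mono[OF that] unfolding game_region_def by (simp add: subset_iff)
    have "legal_I \<kappa> X ?p (response \<kappa> \<sigma> ?p) b" if "b \<in> under \<kappa> a" for b
    proof (cases "b = a")
      case True
      then show ?thesis
        using region C(1) x reg[OF that]
        unfolding legal_I_def by (simp add: subset_openin_subtopology)
    next
      case False
      then have "b \<in> underS \<kappa> a" using that under_eq_insert[OF a] by blast
      then show ?thesis using legal[of b] reg[OF that] False unfolding legal_I_def by simp
    qed
    then have "legal_II \<kappa> X ?p (response \<kappa> \<sigma> ?p) a"
      using winning ofilter_under[of a] under_eq_insert[OF a] unfolding winning_strategy_II_def by blast
    then have *: "openin (subtopology X (game_region \<kappa> X (response \<kappa> \<sigma> p) a)) (R x)"
      "x \<in> R x" "R x \<subseteq> C"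
      using reg[of a] under_eq_insert[OF a] unfolding legal_II_def R_def by simp_all
    then obtain T where T: "openin X T" "R x = T \<inter> game_region \<kappa> X (response \<kappa> \<sigma> p) a"
      unfolding openin_subtopology by blast
    then have "R x = T \<inter> C" using *(3) region by blast
    then show "openin X (R x)" "x \<in> R x" "R x \<subseteq> C" using * T(1) C(1) by (simp_all add: openin_Int)
  qed
  obtain l where l: "locally_constant_on X C l" "l ` C = L"
    using L C unfolding splits_onto_def by blast
  define N where "N x = R x \<inter> {y \<in> C. l y = l x} \<inter> (if x \<in> B a then B a else topspace X - B a)" for x
  have N: "openin X (N x) \<and> x \<in> N x" if "x \<in> C" for x
    using R[OF that] locally_constant_on_fibre[OF l(1), of "l x"] base that openin_subset[OF C(1)]
    unfolding N_def clopen_base_def by (auto intro!: openin_Int)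
  obtain i q where i: "locally_constant_on X C i" "i ` C \<subseteq> Field \<kappa>"
    "|Field \<kappa>| \<le>o |i ` C| \<Longrightarrow> i ` C = Field \<kappa>"
    and q: "\<And>x. x \<in> C \<Longrightarrow> q (i x) \<in> C" "\<And>x. x \<in> C \<Longrightarrow> x \<in> N (q (i x))"
    by (rule disjoint_refinement[OF additive base C(1), of N]) (use N in blast)+
  define v where "v x = (i x, l x, q (i x))" for x
  have "cell_ok a C p L v"
    unfolding cell_ok_def
  proof (intro conjI ballI impI)
    fix x assume x: "x \<in> C"
    show "openin X {y \<in> C. fst (v y) = fst (v x)}"
      unfolding v_def using locally_constant_on_fibre[OF i(1)] by simp
    show "snd (snd (v x)) \<in> C" unfolding v_def using q(1)[OF x] by simp
    fix y assume y: "y \<in> C" "fst (v y) = fst (v x)"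
    have same: "i y = i x" using y(2) by (simp add: v_def)
    have xN: "x \<in> N (q (i x))" and yN: "y \<in> N (q (i x))"
      using q(2)[OF x] q(2)[OF y(1)] same by simp_all
    have "l x = l (q (i x))" "l y = l (q (i x))"
      using xN yN unfolding N_def by blast+
    then show "v y = v x" unfolding v_def using same by simp
    show "y \<in> B a \<longleftrightarrow> x \<in> B a" using xN yN unfolding N_def by (auto split: if_splits)
    show "y \<in> response \<kappa> \<sigma> (p(a := (C, snd (snd (v x))))) a"
      using yN unfolding N_def R_def v_def by simp
  next
    show "(\<lambda>y. fst (snd (v y))) ` C = L" unfolding v_def using l(2) by simp
    show "(\<lambda>y. fst (v y)) ` C \<subseteq> Field \<kappa>" unfolding v_def using i(2) by simp
    show "(\<lambda>y. fst (v y)) ` C = Field \<kappa>" if "|Field \<kappa>| \<le>o |(\<lambda>y. fst (v y)) ` C|"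
      using that i(3) unfolding v_def by simp
  qed
  then show ?thesis by blast
qed

text \<open>
  The construction runs for all points at once: \<open>g a x\<close> is the value at level \<open>a\<close> for the point
  \<open>x\<close>. Thus no bookkeeping of branches is needed, as the cell of \<open>x\<close> and the run \<open>play g x\<close>
  of the game along \<open>x\<close> can be read off from \<open>g\<close>.
\<close>

definition cell :: "('k \<Rightarrow> 'a \<Rightarrow> 'k \<times> 'l \<times> 'a) \<Rightarrow> 'k \<Rightarrow> 'a \<Rightarrow> 'a set" where
  "cell g a x = {y \<in> A. \<forall>b\<in>underS \<kappa> a. fst (g b y) = fst (g b x)}"

definition play :: "('k \<Rightarrow> 'a \<Rightarrow> 'k \<times> 'l \<times> 'a) \<Rightarrow> 'a \<Rightarrow> 'k \<Rightarrow> 'a set \<times> 'a" where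
  "play g x b = (cell g b x, snd (snd (g b x)))"

definition stage :: "('k \<Rightarrow> 'a \<Rightarrow> 'k \<times> 'l \<times> 'a) \<Rightarrow> 'k \<Rightarrow> ('a \<Rightarrow> 'k \<times> 'l \<times> 'a) \<Rightarrow> bool" where
  "stage g a v \<longleftrightarrow>
     (\<forall>x\<in>A. cell_ok a (cell g a x) (play g x) (K a (\<lambda>b. fst (snd (g b x)))) v)"

lemma cell_self: "x \<in> A \<Longrightarrow> x \<in> cell g a x"
  by (simp add: cell_def)

lemma cell_eq: "y \<in> cell g a x \<Longrightarrow> cell g a y = cell g a x"
  unfolding cell_def by auto

lemma cell_subset: "cell g a x \<subseteq> A"
  by (auto simp: cell_def)

lemma cell_antimono: "b \<in> under \<kappa> a \<Longrightarrow> cell g a x \<subseteq> cell g b x"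
  using underS_mono unfolding cell_def by blast

lemma cell_cong: "(\<And>b. b \<in> underS \<kappa> a \<Longrightarrow> g b = g' b) \<Longrightarrow> cell g a x = cell g' a x"
  by (simp add: cell_def)

lemma stage_cong:
  assumes "a \<in> Field \<kappa>" and g: "\<And>b. b \<in> underS \<kappa> a \<Longrightarrow> g b = g' b"
    and "stage g a v"
  shows "stage g' a v"
  unfolding stage_def
proof
  fix x assume "x \<in> A"
  then have "cell_ok a (cell g a x) (play g x) (K a (\<lambda>b. fst (snd (g b x)))) v"
    using assms(3) unfolding stage_def by blast
  moreover have "cell g a x = cell g' a x" by (rule cell_cong[OF g])
  moreover have "K a (\<lambda>b. fst (snd (g b x))) = K a (\<lambda>b. fst (snd (g' b x)))"
    by (rule K_local[OF assms(1)]) (simp add: g)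
  moreover have "play g x b = play g' x b" if "b \<in> underS \<kappa> a" for b
  proof -
    have "cell g b x = cell g' b x"
      by (rule cell_cong) (use g underS_trans that in blast)
    then show ?thesis using g[OF that] by (simp add: play_def)
  qed
  ultimately show "cell_ok a (cell g' a x) (play g' x) (K a (\<lambda>b. fst (snd (g' b x)))) v"
    using cell_ok_cong[OF assms(1), of "play g x" "play g' x" _ v v] by simp
qed

context
  fixes g a
  assumes a: "a \<in> Field \<kappa>" and below: "\<forall>b\<in>underS \<kappa> a. stage g b (g b)"
begin

lemma below_ok:
  "b \<in> underS \<kappa> a \<Longrightarrow> x \<in> A \<Longrightarrow>
    cell_ok b (cell g b x) (play g x) (K b (\<lambda>b. fst (snd (g b x)))) (g b)"
  using below unfolding stage_def by blast

text \<open>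
  Points of the same cell share their earlier values and hence their run; the cell
  at level \<open>a\<close> lies in all earlier answers of II, so that I may legally play it.
\<close>

lemma same_cell:
  assumes "x \<in> A" "y \<in> cell g a x" "b \<in> underS \<kappa> a"
  shows "g b y = g b x" "y \<in> response \<kappa> \<sigma> (play g x) b"
proof -
  have "y \<in> cell g b x"
    using assms(2,3) cell_antimono[of b a] underS_subset_under by fast
  moreover have "fst (g b y) = fst (g b x)" using assms(2,3) unfolding cell_def by blast
  moreover have "(play g x)(b := (cell g b x, snd (snd (g b x)))) = play g x"
    by (rule fun_upd_idem) (simp add: play_def)
  ultimately show "g b y = g b x" "y \<in> response \<kappa> \<sigma> (play g x) b"
    using cell_okD(3,5)[OF below_ok[OF assms(3,1)] cell_self[OF assms(1)], of y] by simp_all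
qed

lemma open_cell:
  assumes "x \<in> A"
  shows "openin X (cell g a x)"
proof -
  let ?P = "\<lambda>b. {y \<in> cell g b x. fst (g b y) = fst (g b x)}"
  have "openin X (A \<inter> (\<Inter>b\<in>underS \<kappa> a. ?P b))"
    using additive_INT_in_open[OF additive small_underS[OF a] _ open_A]
      cell_okD(1)[OF below_ok[OF _ assms] cell_self[OF assms]] by simp
  moreover have "A \<inter> (\<Inter>b\<in>underS \<kappa> a. ?P b) = cell g a x"
    using underS_trans unfolding cell_def by blast
  ultimately show ?thesis by simp
qed

lemma cell_in_region:
  assumes "x \<in> A"
  shows "cell g a x \<subseteq> game_region \<kappa> X (response \<kappa> \<sigma> (play g x)) a"
  using same_cell(2)[OF assms] openin_subset[OF open_cell[OF assms]] unfolding game_region_def by blast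

end

lemma play_legal:
  assumes "a \<in> Field \<kappa>" "\<forall>b\<in>under \<kappa> a. stage g b (g b)" "x \<in> A"
  shows "legal_I \<kappa> X (play g x) (response \<kappa> \<sigma> (play g x)) a"
proof -
  have st: "\<forall>b\<in>underS \<kappa> a. stage g b (g b)"
    using assms(2) underS_subset_under by fast
  have "stage g a (g a)" using assms(1,2) under_eq_insert by blast
  then have "snd (snd (g a x)) \<in> cell g a x"
    using cell_okD(2)[OF _ cell_self[OF assms(3)]] assms(3) unfolding stage_def by blast
  moreover have "openin X (cell g a x)" by (rule open_cell[OF assms(1) st assms(3)])
  moreover have "cell g a x \<subseteq> game_region \<kappa> X (response \<kappa> \<sigma> (play g x)) a"
    by (rule cell_in_region[OF assms(1) st assms(3)])
  ultimately show ?thesis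
    unfolding legal_I_def play_def by (simp add: subset_openin_subtopology)
qed

text \<open>
  All points of a cell must use the same partition of that cell; hence the partition is chosen
  along with a representative point of the cell.
\<close>

lemma stage_exists:
  assumes a: "a \<in> Field \<kappa>" and below: "\<forall>b\<in>underS \<kappa> a. stage g b (g b)"
  shows "\<exists>v. stage g a v"
proof -
  note same = same_cell[OF a below]
  let ?L = "\<lambda>x. K a (\<lambda>b. fst (snd (g b x)))"
  have "\<exists>v. cell_ok a (cell g a x) (play g x) (?L x) v" if x: "x \<in> A" for x
  proof (rule cell_ok_exists[OF a])
    show "openin X (cell g a x)" by (rule open_cell[OF a below x])
    show "cell g a x \<noteq> {}" using cell_self[OF x] by blast
    show "cell g a x \<subseteq> game_region \<kappa> X (response \<kappa> \<sigma> (play g x)) a"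
      by (rule cell_in_region[OF a below x])
    show "splits_onto X (?L x)" by (rule K_splits[OF a])
    fix b assume b: "b \<in> underS \<kappa> a"
    show "legal_I \<kappa> X (play g x) (response \<kappa> \<sigma> (play g x)) b"
    proof (rule play_legal[OF _ _ x])
      show "b \<in> Field \<kappa>" using b underS_subset_Field by blast
      show "\<forall>c\<in>under \<kappa> b. stage g c (g c)"
        using below under_subset_underS[OF b] by blast
    qed
  qed
  then obtain V where V: "\<And>x. x \<in> A \<Longrightarrow> cell_ok a (cell g a x) (play g x) (?L x) (V x)"
    by metis
  define rep where "rep C = (SOME x. x \<in> C)" for C :: "'a set"
  define v where "v y = V (rep (cell g a y)) y" for y
  have "stage g a v"
    unfolding stage_def
  proof
    fix x assume x: "x \<in> A"
    define r where "r = rep (cell g a x)"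
    have r: "r \<in> cell g a x" unfolding r_def rep_def using cell_self[OF x] by (rule someI)
    then have rA: "r \<in> A" using cell_subset by blast
    have "cell g a r = cell g a x" by (rule cell_eq[OF r])
    moreover have "?L r = ?L x" by (rule K_local[OF a]) (simp add: same(1)[OF x r])
    ultimately have "cell_ok a (cell g a x) (play g r) (?L x) (V r)" using V[OF rA] by simp
    then show "cell_ok a (cell g a x) (play g x) (?L x) v"
    proof (rule cell_ok_cong[OF a, rotated 2])
      show "V r y = v y" if "y \<in> cell g a x" for y
        using cell_eq[OF that] by (simp add: v_def r_def)
      show "play g r b = play g x b" if b: "b \<in> underS \<kappa> a" for b
      proof -
        have "r \<in> cell g b x" using r cell_antimono[of b a] b underS_subset_under by fast
        then show ?thesis using cell_eq[of r g b x] same(1)[OF x r b] by (simp add: play_def)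
      qed
    qed
  qed
  then show ?thesis by blast
qed

text \<open>
  Indices of limit length are realised since the points witnessing the levels below the limit
  give one and the same run of the game, up to those levels; II wins it, and a common point of the answers
  lies in all the cells.
\<close>

theorem tree_coding_exists:
  obtains f l where "tree_coding \<kappa> X A K f l"
proof -
  have "\<exists>g. \<forall>a\<in>Field \<kappa>. stage g a (g a)"
  proof (rule transfinite_choice[of stage])
    fix g g' :: "'k \<Rightarrow> 'a \<Rightarrow> 'k \<times> 'l \<times> 'a" and a v
    assume a: "a \<in> Field \<kappa>"
    show "stage g a v \<longleftrightarrow> stage g' a v" if "\<And>b. b \<in> underS \<kappa> a \<Longrightarrow> g b = g' b"
      using stage_cong[OF a, of g g' v] stage_cong[OF a, of g' g v] that by force
    show "\<exists>v. stage g a v" if "\<And>b. b \<in> underS \<kappa> a \<Longrightarrow> stage g b (g b)"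
      by (rule stage_exists[OF a]) (use that in blast)
  qed blast
  then obtain g where g: "\<And>a. a \<in> Field \<kappa> \<Longrightarrow> stage g a (g a)" by blast
  have below: "\<forall>b\<in>underS \<kappa> a. stage g b (g b)" for a
    using g underS_subset_Field by blast
  note ok = g[unfolded stage_def, rule_format]
  define f where "f a x = fst (g a x)" for a x
  define l where "l a x = fst (snd (g a x))" for a x
  have cell: "{y \<in> A. \<forall>b\<in>underS \<kappa> a. f b y = f b x} = cell g a x" for a x
    by (simp add: cell_def f_def)
  have determined: "g a y = g a x"
    if a: "a \<in> Field \<kappa>" and x: "x \<in> A" and y: "y \<in> A"
      and eq: "\<And>b. b \<in> under \<kappa> a \<Longrightarrow> f b y = f b x" for a x y
  proof -
    have "y \<in> cell g a x" "fst (g a y) = fst (g a x)"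
      using y eq under_eq_insert[OF a] unfolding cell_def f_def by blast+
    then show ?thesis using cell_okD(3)[OF ok[OF a x] cell_self[OF x]] by blast
  qed
  have "tree_coding \<kappa> X A K f l"
  proof (unfold_locales, fact K_local, unfold cell)
    fix a x assume a: "a \<in> Field \<kappa>" and x: "x \<in> A"
    show "f a x \<in> Field \<kappa>"
      unfolding f_def by (rule cell_okD(6)[OF ok[OF a x] cell_self[OF x]])
    show "openin X (cell g a x)" by (rule open_cell[OF a below x])
    show "l a ` cell g a x = K a (\<lambda>b. l b x)"
      using ok[OF a x] unfolding cell_ok_def l_def by simp
    show "f a ` cell g a x = Field \<kappa>" if "|Field \<kappa>| \<le>o |f a ` cell g a x|"
      using ok[OF a x] that unfolding cell_ok_def f_def by simp
    show "l a y = l a x" if "y \<in> A" "\<And>b. b \<in> under \<kappa> a \<Longrightarrow> f b y = f b x" for y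
      using determined[OF a x that] by (simp add: l_def)
  next
    fix x U assume x: "x \<in> A" and U: "openin X U" "x \<in> U"
    obtain a where a: "a \<in> Field \<kappa>" "x \<in> B a" "B a \<subseteq> U"
      using base U unfolding clopen_base_def by blast
    obtain c where c: "c \<in> Field \<kappa>" "underS \<kappa> c = under \<kappa> a" using successor_exists[OF a(1)] .
    have "y \<in> U" if "y \<in> A" "\<forall>b\<in>underS \<kappa> c. f b y = f b x" for y
    proof -
      have "y \<in> cell g a x" "fst (g a y) = fst (g a x)"
        using that c(2) under_eq_insert[OF a(1)] unfolding cell_def f_def by auto
      then have "y \<in> B a" using cell_okD(4)[OF ok[OF a(1) x] cell_self[OF x]] a(2) by blast
      then show ?thesis using a(3) by blast
    qed
    then show "\<exists>a\<in>Field \<kappa>. \<forall>y\<in>A. (\<forall>b\<in>underS \<kappa> a. f b y = f b x) \<longrightarrow> y \<in> U" using c(1) by blast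
  next
    fix D z assume D: "limit_segment \<kappa> D"
      and ex: "\<And>a. a \<in> D \<Longrightarrow> \<exists>x\<in>A. \<forall>b\<in>under \<kappa> a. f b x = z b"
    have seg: "wo_rel.ofilter \<kappa> D" and ne: "D \<noteq> {}" and up: "\<And>a. a \<in> D \<Longrightarrow> \<exists>b\<in>D. a \<in> underS \<kappa> b"
      using D unfolding limit_segment_def by blast+
    obtain w where w: "\<And>a. a \<in> D \<Longrightarrow> w a \<in> A" "\<And>a b. a \<in> D \<Longrightarrow> b \<in> under \<kappa> a \<Longrightarrow> f b (w a) = z b"
      using ex by metis
    have DF: "a \<in> Field \<kappa>" if "a \<in> D" for a using segment_subset_Field[OF seg] that by blast
    have Dunder: "b \<in> D" if "a \<in> D" "b \<in> under \<kappa> a" for a b using segment_downward_closed[OF seg] that by blast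
    \<comment> \<open>The runs along the witnesses \<open>w a\<close> cohere; \<open>p\<close> is their union.\<close>
    define p where "p a = play g (w a) a" for a
    have p: "p b = play g (w a) b" if a: "a \<in> D" and b: "b \<in> under \<kappa> a" for a b
    proof -
      have bD: "b \<in> D" by (rule Dunder[OF a b])
      have eq: "f c (w b) = f c (w a)" if "c \<in> under \<kappa> b" for c
        using w(2)[OF bD that] w(2)[OF a] under_mono[OF b] that by auto
      have "g b (w b) = g b (w a)" by (rule determined[OF DF[OF bD] w(1)[OF a] w(1)[OF bD] eq])
      moreover have "w b \<in> cell g b (w a)"
        using eq w(1)[OF bD] underS_subset_under unfolding cell_def f_def by fast
      ultimately show ?thesis using cell_eq unfolding p_def play_def by metis
    qed
    have resp: "response \<kappa> \<sigma> p b = response \<kappa> \<sigma> (play g (w a)) b"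
      if a: "a \<in> D" and b: "b \<in> under \<kappa> a" for a b
      by (rule response_cong) (use p[OF a] under_mono[OF b] in blast)
    have leg: "legal_I \<kappa> X p (response \<kappa> \<sigma> p) a" if a: "a \<in> D" for a
    proof -
      have "a \<in> under \<kappa> a" using under_eq_insert[OF DF[OF a]] by blast
      then have "p a = play g (w a) a" by (rule p[OF a])
      moreover have "game_region \<kappa> X (response \<kappa> \<sigma> p) a =
          game_region \<kappa> X (response \<kappa> \<sigma> (play g (w a))) a"
        using resp[OF a] underS_subset_under unfolding game_region_def by (metis (no_types, lifting) INF_cong subsetD)
      moreover have "legal_I \<kappa> X (play g (w a)) (response \<kappa> \<sigma> (play g (w a))) a"
        by (rule play_legal[OF DF[OF a] _ w(1)[OF a]]) (use g under_subset_Field in blast)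
      ultimately show ?thesis unfolding legal_I_def by simp
    qed
    then have II: "\<And>a. a \<in> D \<Longrightarrow> legal_II \<kappa> X p (response \<kappa> \<sigma> p) a"
      and "(\<Inter>a\<in>D. response \<kappa> \<sigma> p a) \<noteq> {}"
      using winning seg D unfolding winning_strategy_II_def by blast+
    then obtain t where t: "\<And>a. a \<in> D \<Longrightarrow> t \<in> response \<kappa> \<sigma> p a" by blast
    have tc: "t \<in> cell g a (w a)" if "a \<in> D" for a
      using t[OF that] II[OF that] unfolding legal_II_def p_def play_def by auto
    have "f b t = z b" if "b \<in> D" for b
    proof -
      obtain a where a: "a \<in> D" "b \<in> underS \<kappa> a" using up \<open>b \<in> D\<close> by blast
      have "f b t = f b (w a)" using tc[OF a(1)] a(2) unfolding cell_def f_def by blast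
      also have "\<dots> = z b" using w(2)[OF a(1)] a(2) underS_subset_under by fast
      finally show ?thesis .
    qed
    moreover have "t \<in> A" using tc ne cell_subset by fast
    ultimately show "\<exists>x\<in>A. \<forall>b\<in>D. f b x = z b" by blast
  qed
  then show ?thesis by (rule that)
qed

end

section \<open>The topology of the generalized Baire space\<close>

context regular_uncountable
begin

lemma in_maps_iff: "f \<in> maps P Q \<longleftrightarrow> (\<forall>b. b \<notin> P \<longrightarrow> f b = None) \<and> (\<forall>b\<in>P. \<exists>c\<in>Q. f b = Some c)"
proof
  assume "f \<in> maps P Q"
  then show "(\<forall>b. b \<notin> P \<longrightarrow> f b = None) \<and> (\<forall>b\<in>P. \<exists>c\<in>Q. f b = Some c)"
    unfolding maps_def by (auto simp: dom_def ran_def)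
next
  assume *: "(\<forall>b. b \<notin> P \<longrightarrow> f b = None) \<and> (\<forall>b\<in>P. \<exists>c\<in>Q. f b = Some c)"
  then have "dom f = P" by (force simp: dom_def)
  moreover have "ran f \<subseteq> Q"
  proof
    fix c assume "c \<in> ran f"
    then obtain b where b: "f b = Some c" by (auto simp: ran_def)
    then have "b \<in> P" using * by fastforce
    then obtain d where "d \<in> Q" "f b = Some d" using * by blast
    then show "c \<in> Q" using b by simp
  qed
  ultimately show "f \<in> maps P Q" by (simp add: maps_def)
qed

definition agree :: "'k \<Rightarrow> ('k \<Rightarrow> 'b) \<Rightarrow> ('k \<Rightarrow> 'b) \<Rightarrow> bool" where
  "agree a x y \<longleftrightarrow> (\<forall>b\<in>underS \<kappa> a. x b = y b)"

lemma agree_mono: "agree a x y \<Longrightarrow> b \<in> under \<kappa> a \<Longrightarrow> agree b x y"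
  using underS_mono unfolding agree_def by blast

lemma map_le_restrict_iff:
  assumes "x \<in> maps (Field \<kappa>) Q" "y \<in> maps (Field \<kappa>) Q'"
  shows "x |` underS \<kappa> a \<subseteq>\<^sub>m y \<longleftrightarrow> agree a y x"
proof -
  have dom: "dom (x |` underS \<kappa> a) = underS \<kappa> a"
    using assms(1) underS_subset_Field[of a] unfolding maps_def by auto
  show ?thesis unfolding map_le_def agree_def dom by (auto simp: restrict_map_def)
qed

lemma restrict_bounded_seq:
  assumes "x \<in> maps (Field \<kappa>) Q" "a \<in> Field \<kappa>"
  shows "x |` underS \<kappa> a \<in> bounded_seqs \<kappa> Q"
proof -
  have "x |` underS \<kappa> a \<in> maps (underS \<kappa> a) Q"
    using assms(1) underS_subset_Field[of a] unfolding in_maps_iff by (auto simp: restrict_map_def)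
  then show ?thesis using assms(2) unfolding bounded_seqs_def by blast
qed

lemma max_exists:
  assumes "a \<in> Field \<kappa>" "b \<in> Field \<kappa>"
  obtains c where "c \<in> Field \<kappa>" "a \<in> under \<kappa> c" "b \<in> under \<kappa> c"
  using le_total[OF assms] le_refl assms that unfolding under_def by blast

lemma openin_gen_baire:
  "openin (gen_baire \<kappa>) U \<longleftrightarrow>
     U \<subseteq> maps (Field \<kappa>) (Field \<kappa>) \<and>
     (\<forall>x\<in>U. \<exists>a\<in>Field \<kappa>. \<forall>y\<in>maps (Field \<kappa>) (Field \<kappa>). agree a y x \<longrightarrow> y \<in> U)"
    (is "_ \<longleftrightarrow> U \<subseteq> ?M \<and> ?nb U")
proof
  define S where "S = (\<lambda>s. {x \<in> ?M. s \<subseteq>\<^sub>m x}) ` bounded_seqs \<kappa> (Field \<kappa>)"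
  {
    assume "openin (gen_baire \<kappa>) U"
    then have "generate_topology_on S U"
      unfolding gen_baire_def S_def by (simp add: openin_topology_generated_by_iff)
    then show "U \<subseteq> ?M \<and> ?nb U"
    proof (induction rule: generate_topology_on.induct)
      case Empty
      show ?case by simp
    next
      case (Int U V)
      have "?nb (U \<inter> V)"
      proof
        fix x assume x: "x \<in> U \<inter> V"
        obtain a where a: "a \<in> Field \<kappa>" "\<forall>y\<in>?M. agree a y x \<longrightarrow> y \<in> U" using Int.IH(1) x by blast
        obtain b where b: "b \<in> Field \<kappa>" "\<forall>y\<in>?M. agree b y x \<longrightarrow> y \<in> V" using Int.IH(2) x by blast
        obtain c where c: "c \<in> Field \<kappa>" "a \<in> under \<kappa> c" "b \<in> under \<kappa> c" by (rule max_exists[OF a(1) b(1)])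
        have "\<forall>y\<in>?M. agree c y x \<longrightarrow> y \<in> U \<inter> V"
          using a(2) b(2) agree_mono[OF _ c(2)] agree_mono[OF _ c(3)] by blast
        then show "\<exists>a\<in>Field \<kappa>. \<forall>y\<in>?M. agree a y x \<longrightarrow> y \<in> U \<inter> V" using c(1) by blast
      qed
      then show ?case using Int.IH by blast
    next
      case (UN \<U>)
      have "?nb (\<Union>\<U>)"
      proof
        fix x assume "x \<in> \<Union>\<U>"
        then obtain V where V: "V \<in> \<U>" "x \<in> V" by blast
        then obtain a where "a \<in> Field \<kappa>" "\<forall>y\<in>?M. agree a y x \<longrightarrow> y \<in> V" using UN.IH by blast
        then show "\<exists>a\<in>Field \<kappa>. \<forall>y\<in>?M. agree a y x \<longrightarrow> y \<in> \<Union>\<U>" using V(1) by blast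
      qed
      then show ?case using UN.IH by blast
    next
      case (Basis V)
      then obtain s where s: "s \<in> bounded_seqs \<kappa> (Field \<kappa>)" "V = {x \<in> ?M. s \<subseteq>\<^sub>m x}"
        unfolding S_def by blast
      obtain a where a: "a \<in> Field \<kappa>" "dom s = underS \<kappa> a"
        using s(1) unfolding bounded_seqs_def maps_def by blast
      have "\<forall>y\<in>?M. agree a y x \<longrightarrow> y \<in> V" if "x \<in> V" for x
        using that a(2) unfolding s(2) map_le_def agree_def by simp
      then show ?case using a(1) s(2) by blast
    qed
  next
    assume U: "U \<subseteq> ?M \<and> ?nb U"
    show "openin (gen_baire \<kappa>) U"
    proof (subst openin_subopen, intro ballI)
      fix x assume x: "x \<in> U"
      then obtain a where a: "a \<in> Field \<kappa>" "\<forall>y\<in>?M. agree a y x \<longrightarrow> y \<in> U" using U by blast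
      have xM: "x \<in> ?M" using U x by blast
      let ?V = "{y \<in> ?M. x |` underS \<kappa> a \<subseteq>\<^sub>m y}"
      have "?V \<in> S"
        unfolding S_def using restrict_bounded_seq[OF xM a(1)] by blast
      then have "openin (gen_baire \<kappa>) ?V"
        unfolding gen_baire_def S_def by (rule topology_generated_by_Basis)
      moreover have "x \<in> ?V" using xM map_le_restrict_iff[OF xM xM] by (simp add: agree_def)
      moreover have "?V \<subseteq> U" using a(2) map_le_restrict_iff[OF xM] by blast
      ultimately show "\<exists>T. openin (gen_baire \<kappa>) T \<and> x \<in> T \<and> T \<subseteq> U" by blast
    qed
  }
qed

lemma topspace_gen_baire: "topspace (gen_baire \<kappa>) = maps (Field \<kappa>) (Field \<kappa>)"
proof
  show "topspace (gen_baire \<kappa>) \<subseteq> maps (Field \<kappa>) (Field \<kappa>)"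
    using openin_gen_baire[of "topspace (gen_baire \<kappa>)"] by simp
  have "Field \<kappa> \<noteq> {}" using infinite_Field by auto
  then have "openin (gen_baire \<kappa>) (maps (Field \<kappa>) (Field \<kappa>))"
    unfolding openin_gen_baire by blast
  then show "maps (Field \<kappa>) (Field \<kappa>) \<subseteq> topspace (gen_baire \<kappa>)" by (rule openin_subset)
qed

section \<open>Realising indices and labels\<close>

lemma coding_exists:
  fixes X :: "'a topology" and K :: "'k \<Rightarrow> ('k \<Rightarrow> 'l) \<Rightarrow> 'l set"
  assumes "additive_space \<kappa> X" "SC_space \<kappa> X" "openin X A"
    and "\<And>a s s'. a \<in> Field \<kappa> \<Longrightarrow> (\<And>b. b \<in> underS \<kappa> a \<Longrightarrow> s b = s' b) \<Longrightarrow> K a s = K a s'"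
    and "\<And>a s. a \<in> Field \<kappa> \<Longrightarrow> splits_onto X (K a s)"
  obtains f l where "tree_coding \<kappa> X A K f l"
proof -
  obtain B where "clopen_base X B"
    using clopen_base_exists assms(1,2) unfolding SC_space_def by metis
  moreover obtain \<sigma> where "winning_strategy_II \<kappa> X \<sigma>"
    using assms(2) unfolding SC_space_def by blast
  ultimately have "choquet_scheme \<kappa> X B \<sigma> A K"
  proof (unfold_locales)
    show "K a s = K a s'" if "a \<in> Field \<kappa>" "\<And>b. b \<in> underS \<kappa> a \<Longrightarrow> s b = s' b" for a s s'
      by (rule assms(4)[OF that])
    show "splits_onto X (K a s)" if "a \<in> Field \<kappa>" for a s by (rule assms(5)[OF that])
    show "additive_space \<kappa> X" "openin X A" by (fact assms)+
  qed assumption+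
  then show ?thesis using choquet_scheme.tree_coding_exists that by blast
qed

end

context tree_coding
begin

text \<open>
  A segment that is not a limit is empty or has a last element \<open>a\<close>, and then the hypothesis for
  \<open>a\<close> already concerns the whole segment.
\<close>

lemma segment_realized:
  assumes "wo_rel.ofilter \<kappa> D" "A \<noteq> {}"
    and ex: "\<And>a. a \<in> D \<Longrightarrow> \<exists>x\<in>A. \<forall>b\<in>under \<kappa> a. f b x = z b"
  shows "\<exists>x\<in>A. \<forall>b\<in>D. f b x = z b"
proof (rule segment_cases[OF assms(1)])
  show ?thesis if "D = {}" using that assms(2) by blast
  show ?thesis if "a \<in> D" "D = under \<kappa> a" for a using that ex by blast
  show ?thesis if "limit_segment \<kappa> D" using limit_realized[OF that ex] by blast
qed

lemma labels_determined:
  assumes "a \<in> Field \<kappa>" "x \<in> A" "y \<in> A" "\<And>b. b \<in> underS \<kappa> a \<Longrightarrow> f b y = f b x"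
    and "b \<in> underS \<kappa> a"
  shows "l b y = l b x"
  by (rule label_determined[OF _ assms(2,3)])
    (use assms(4,5) under_subset_underS[OF assms(5)] underS_subset_Field in blast)+

lemma label_in: "a \<in> Field \<kappa> \<Longrightarrow> x \<in> A \<Longrightarrow> l a x \<in> K a (\<lambda>b. l b x)"
  using labels_of_cell[of a x] by blast

lemma label_cell_open:
  assumes "a \<in> Field \<kappa>"
  shows "openin X {y \<in> A. \<forall>b\<in>underS \<kappa> a. l b y = z b}"
proof (subst openin_subopen, intro ballI)
  fix x assume x: "x \<in> {y \<in> A. \<forall>b\<in>underS \<kappa> a. l b y = z b}"
  let ?C = "{y \<in> A. \<forall>b\<in>underS \<kappa> a. f b y = f b x}"
  have "openin X ?C" using cell_open[OF assms] x by blast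
  moreover have "?C \<subseteq> {y \<in> A. \<forall>b\<in>underS \<kappa> a. l b y = z b}"
    using labels_determined[OF assms, of x] x by auto
  ultimately show "\<exists>T. openin X T \<and> x \<in> T \<and> T \<subseteq> {y \<in> A. \<forall>b\<in>underS \<kappa> a. l b y = z b}"
    using x by (intro exI[of _ ?C]) simp
qed

text \<open>
  Indices are chosen along \<open>z\<close> one level at a time such that the indices so far are realised
  by points with labels \<open>z\<close>. At level \<open>a\<close> the earlier indices are realised by a point \<open>y\<close>; its
  earlier labels are determined by them, hence are those of \<open>z\<close>, and the labels available
  in its cell form the set \<open>K a z\<close>, which contains \<open>z a\<close>.
\<close>

lemma labels_realized:
  assumes D: "wo_rel.ofilter \<kappa> D" and ne: "A \<noteq> {}" and z: "\<And>a. a \<in> D \<Longrightarrow> z a \<in> K a z"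
  shows "\<exists>x\<in>A. \<forall>a\<in>D. l a x = z a"
proof -
  \<comment> \<open>\<open>v\<close> continues the index sequence \<open>g\<close> so that some point has these indices and the labels \<open>z\<close>.\<close>
  define P where "P g a v \<longleftrightarrow> (a \<in> D \<longrightarrow> (\<exists>y\<in>A. (\<forall>b\<in>underS \<kappa> a. f b y = g b) \<and> f a y = v \<and>
      (\<forall>b\<in>under \<kappa> a. l b y = z b)))" for g a v
  have hd: "\<exists>y\<in>A. (\<forall>b\<in>under \<kappa> a. f b y = g b) \<and> (\<forall>b\<in>under \<kappa> a. l b y = z b)"
    if "P g a (g a)" "a \<in> D" for g a
  proof -
    obtain y where "y \<in> A" "\<forall>b\<in>underS \<kappa> a. f b y = g b" "f a y = g a" "\<forall>b\<in>under \<kappa> a. l b y = z b"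
      using \<open>P g a (g a)\<close> \<open>a \<in> D\<close> unfolding P_def by blast
    moreover have "a \<in> Field \<kappa>" using \<open>a \<in> D\<close> segment_subset_Field[OF D] by blast
    ultimately show ?thesis using under_eq_insert by auto
  qed
  have glue: "\<exists>y\<in>A. \<forall>b\<in>E. f b y = g b \<and> l b y = z b"
    if E: "wo_rel.ofilter \<kappa> E" "E \<subseteq> D" and g: "\<And>b. b \<in> E \<Longrightarrow> P g b (g b)" for E g
  proof -
    have "\<exists>y\<in>A. \<forall>b\<in>E. f b y = g b"
      by (rule segment_realized[OF E(1) ne]) (use hd g E(2) in blast)
    then obtain y where y: "y \<in> A" "\<And>b. b \<in> E \<Longrightarrow> f b y = g b" by blast
    have "l b y = z b" if b: "b \<in> E" for b
    proof -
      have "b \<in> D" using b E(2) by blast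
      obtain w where w: "w \<in> A" "\<forall>c\<in>under \<kappa> b. f c w = g c" "\<forall>c\<in>under \<kappa> b. l c w = z c"
        using hd[OF g[OF b] \<open>b \<in> D\<close>] by blast
      have bF: "b \<in> Field \<kappa>" using segment_subset_Field[OF E(1)] b by blast
      have "l b y = l b w"
        by (rule label_determined[OF bF w(1) y(1)]) (use w(2) y(2) segment_downward_closed[OF E(1) b] in auto)
      then show ?thesis using w(3) under_eq_insert[OF bF] by simp
    qed
    then show ?thesis using y by blast
  qed
  have "\<exists>g. \<forall>a\<in>Field \<kappa>. P g a (g a)"
  proof (rule transfinite_choice[of P])
    fix g g' :: "'k \<Rightarrow> 'k" and a v
    assume a: "a \<in> Field \<kappa>"
    show "P g a v \<longleftrightarrow> P g' a v" if "\<And>b. b \<in> underS \<kappa> a \<Longrightarrow> g b = g' b"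
      using that unfolding P_def by simp
    show "\<exists>v. P g a v" if below: "\<And>b. b \<in> underS \<kappa> a \<Longrightarrow> P g b (g b)"
    proof (cases "a \<in> D")
      case True
      have "underS \<kappa> a \<subseteq> D" using segment_downward_closed[OF D True] underS_subset_under by fast
      then obtain y where y: "y \<in> A" "\<forall>b\<in>underS \<kappa> a. f b y = g b \<and> l b y = z b"
        using glue[OF ofilter_underS _ below] by blast
      have "K a (\<lambda>b. l b y) = K a z" by (rule K_local[OF a]) (use y(2) in blast)
      then have "z a \<in> l a ` {w \<in> A. \<forall>b\<in>underS \<kappa> a. f b w = f b y}"
        using z[OF True] labels_of_cell[OF a y(1)] by simp
      then obtain w where w: "w \<in> A" "\<forall>b\<in>underS \<kappa> a. f b w = f b y" "l a w = z a" by auto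
      have "l b w = z b" if "b \<in> underS \<kappa> a" for b
        using labels_determined[OF a y(1) w(1) _ that] w(2) y(2) that by simp
      then have "\<forall>b\<in>under \<kappa> a. l b w = z b" using w(3) under_eq_insert[OF a] by simp
      moreover have "\<forall>b\<in>underS \<kappa> a. f b w = g b" using w(2) y(2) by simp
      ultimately have "P g a (f a w)" unfolding P_def using w(1) by blast
      then show ?thesis by blast
    qed (simp add: P_def)
  qed blast
  then obtain g where "\<And>a. a \<in> Field \<kappa> \<Longrightarrow> P g a (g a)" by blast
  then have "\<exists>y\<in>A. \<forall>b\<in>D. f b y = g b \<and> l b y = z b"
    using glue[OF D] segment_subset_Field[OF D] by blast
  then show ?thesis by blast
qed

end

context regular_uncountable
begin

section \<open>Partitions into \<open>\<kappa>\<close> pieces without weak compactness\<close>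

text \<open>
  It suffices to have at least \<open>\<kappa>\<close> pieces, since pieces can be united.
\<close>

lemma splits_onto_FieldI:
  fixes X :: "'a topology"
  assumes "\<And>A. openin X A \<Longrightarrow> A \<noteq> {} \<Longrightarrow> \<exists>h :: 'a \<Rightarrow> 'c. locally_constant_on X A h \<and> |Field \<kappa>| \<le>o |h ` A|"
  shows "splits_onto X (Field \<kappa>)"
  unfolding splits_onto_def
proof (intro allI impI)
  fix A assume "openin X A \<and> A \<noteq> {}"
  then have "\<exists>h :: 'a \<Rightarrow> 'c. locally_constant_on X A h \<and> |Field \<kappa>| \<le>o |h ` A|" by (simp add: assms)
  then obtain h :: "'a \<Rightarrow> 'c" where "locally_constant_on X A h \<and> |Field \<kappa>| \<le>o |h ` A|" ..
  then have h: "locally_constant_on X A h" "|Field \<kappa>| \<le>o |h ` A|" by simp_all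
  have "Field \<kappa> \<noteq> {}" using infinite_Field by auto
  then obtain g where "g ` h ` A = Field \<kappa>"
    using h(2) card_of_ordLeq2[of "Field \<kappa>" "h ` A"] by auto
  then have "(\<lambda>x. g (h x)) ` A = Field \<kappa>" by (simp add: image_image)
  then show "\<exists>l. locally_constant_on X A l \<and> l ` A = Field \<kappa>"
    using locally_constant_on_compose[OF h(1), of g] by blast
qed

context
  fixes X :: "'a topology"
  assumes X_additive: "additive_space \<kappa> X" and X_perfect: "perfect_space X" and X_SC: "SC_space \<kappa> X"
begin

lemma small_sets_split:
  fixes L :: "'l set"
  assumes "|L| <o \<kappa>" "L \<noteq> {}"
  shows "splits_onto X L"
proof -
  have r: "regular_space X" "Hausdorff_space X" "weight_le X \<kappa>" using X_SC unfolding SC_space_def by blast+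
  obtain B where B: "clopen_base X B" by (rule clopen_base_exists[OF r(1) X_additive r(3)])
  show ?thesis by (rule small_splits[OF X_additive B r(2) X_perfect assms])
qed

text \<open>
  With both truth values available as labels in every cell, the labels below \<open>a\<close> realise every
  subset of \<open>underS \<kappa> a\<close>, and they are locally constant by additivity.
\<close>

lemma large_power_splits:
  assumes a: "a \<in> Field \<kappa>" and large: "\<kappa> \<le>o |Pow (underS \<kappa> a)|"
  shows "splits_onto X (Field \<kappa>)"
proof (rule splits_onto_FieldI[where 'c = "'k set"])
  fix A assume A: "openin X A" "A \<noteq> {}"
  have two: "splits_onto X (UNIV :: bool set)"
    by (rule small_sets_split) (simp_all add: small_finite)
  obtain f l where "tree_coding \<kappa> X A (\<lambda>_ _. UNIV :: bool set) f l"
    by (rule coding_exists[OF X_additive X_SC A(1), of "\<lambda>_ _. UNIV :: bool set"]) (use two in blast)+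
  then interpret tree_coding \<kappa> X A "\<lambda>_ _. UNIV :: bool set" f l .
  define h where "h x = {b \<in> underS \<kappa> a. l b x}" for x
  have "locally_constant_on X A h"
  proof (rule locally_constant_on_fibrewise)
    fix x
    have "{y \<in> A. h y = h x} = {y \<in> A. \<forall>b\<in>underS \<kappa> a. l b y = l b x}"
      unfolding h_def by blast
    then show "openin X {y \<in> A. h y = h x}" using label_cell_open[OF a, of "\<lambda>b. l b x"] by simp
  qed
  moreover have "Pow (underS \<kappa> a) \<subseteq> h ` A"
  proof
    fix S assume S: "S \<in> Pow (underS \<kappa> a)"
    obtain x where x: "x \<in> A" "\<forall>b\<in>underS \<kappa> a. l b x = (b \<in> S)"
      using labels_realized[OF ofilter_underS[of a] A(2), of "\<lambda>b. b \<in> S"] by blast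
    have "h x = S" unfolding h_def using x(2) S by blast
    then show "S \<in> h ` A" using x(1) by blast
  qed
  then have "|Field \<kappa>| \<le>o |h ` A|"
    using ordLeq_transitive[OF ordIso_ordLeq_trans[OF card_Field large] card_of_mono1] by blast
  ultimately show "\<exists>h :: 'a \<Rightarrow> 'k set. locally_constant_on X A h \<and> |Field \<kappa>| \<le>o |h ` A|"
    by (intro exI[of _ h] conjI)
qed

text \<open>
  The labels of a point follow \<open>T\<close> as long as possible. In the absence of a cofinal branch, the
  label sequence of \<open>x\<close> leaves \<open>T\<close> at a first level \<open>h x\<close>. This level is locally constant, being
  determined by the labels below it, and it is unbounded, because every element of \<open>T\<close> is
  realised as an initial part of a label sequence. By regularity \<open>h\<close> takes \<open>\<kappa>\<close> values. The size of
  the levels matters because only fewer than \<open>\<kappa>\<close> labels can be prescribed in a cell.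
\<close>

lemma tree_splits:
  assumes T: "seq_tree \<kappa> T"
    and levels: "\<And>a. a \<in> Field \<kappa> \<Longrightarrow> T \<inter> maps (underS \<kappa> a) (Field \<kappa>) \<noteq> {}"
      "\<And>a. a \<in> Field \<kappa> \<Longrightarrow> |T \<inter> maps (underS \<kappa> a) (Field \<kappa>)| <o \<kappa>"
    and no_branch: "\<not> (\<exists>x\<in>maps (Field \<kappa>) (Field \<kappa>). \<forall>a\<in>Field \<kappa>. x |` underS \<kappa> a \<in> T)"
  shows "splits_onto X (Field \<kappa>)"
proof (rule splits_onto_FieldI[where 'c = 'k])
  fix A assume A: "openin X A" "A \<noteq> {}"
  define hist where "hist s a = (\<lambda>b. if b \<in> underS \<kappa> a then Some (s b) else None)"
    for s :: "'k \<Rightarrow> 'k" and a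
  define L where "L a s = {i \<in> Field \<kappa>. (hist s a)(a \<mapsto> i) \<in> T}" for a s
  \<comment> \<open>Outside the tree, and at its dead ends, the label is immaterial; one value keeps the set nonempty.\<close>
  define K where "K a s = (if L a s = {} then {a} else L a s)" for a s
  have hist_cong: "hist s a = hist s' a" if "\<And>b. b \<in> underS \<kappa> a \<Longrightarrow> s b = s' b" for s s' a
    unfolding hist_def using that by auto
  have K_cong: "K a s = K a s'" if "\<And>b. b \<in> underS \<kappa> a \<Longrightarrow> s b = s' b" for s s' a
  proof -
    have "hist s a = hist s' a" by (rule hist_cong) (rule that)
    then show ?thesis by (simp only: K_def L_def)
  qed
  have small_L: "|L a s| <o \<kappa>" if a: "a \<in> Field \<kappa>" for a s
  proof -
    obtain c where c: "c \<in> Field \<kappa>" "underS \<kappa> c = under \<kappa> a" using successor_exists[OF a] .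
    have dom: "dom ((hist s a)(a \<mapsto> i)) = underS \<kappa> c" for i
      unfolding c(2) under_eq_insert[OF a] hist_def by (auto simp: dom_def)
    have "(hist s a)(a \<mapsto> i) \<in> T \<inter> maps (underS \<kappa> c) (Field \<kappa>)" if "i \<in> L a s" for i
    proof -
      have "(hist s a)(a \<mapsto> i) \<in> T" using that unfolding L_def by blast
      moreover from this have "ran ((hist s a)(a \<mapsto> i)) \<subseteq> Field \<kappa>"
        using T unfolding seq_tree_def bounded_seqs_def maps_def by blast
      ultimately show ?thesis using dom unfolding maps_def by blast
    qed
    then have "(\<lambda>i. (hist s a)(a \<mapsto> i)) ` L a s \<subseteq> T \<inter> maps (underS \<kappa> c) (Field \<kappa>)" by blast
    moreover have "inj_on (\<lambda>i. (hist s a)(a \<mapsto> i)) (L a s)"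
      by (rule inj_onI) (metis fun_upd_same option.inject)
    ultimately have "|L a s| \<le>o |T \<inter> maps (underS \<kappa> c) (Field \<kappa>)|"
      using card_of_ordLeq[of "L a s"] by blast
    then show ?thesis by (rule ordLeq_ordLess_trans[OF _ levels(2)[OF c(1)]])
  qed
  have "splits_onto X (K a s)" if "a \<in> Field \<kappa>" for a s
    by (rule small_sets_split) (auto simp: K_def small_L that small_finite)
  then obtain f l where "tree_coding \<kappa> X A K f l"
    using coding_exists[OF X_additive X_SC A(1), of K] K_cong by blast
  then interpret tree_coding \<kappa> X A K f l .
  have label_Field: "l a x \<in> Field \<kappa>" if "a \<in> Field \<kappa>" "x \<in> A" for a x
    using label_in[OF that] that(1) unfolding K_def L_def by (auto split: if_splits)
  have "\<exists>a\<in>Field \<kappa>. hist (\<lambda>b. l b x) a \<notin> T \<and> (\<forall>b\<in>underS \<kappa> a. hist (\<lambda>b. l b x) b \<in> T)"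
    if x: "x \<in> A" for x
  proof -
    define t where "t b = (if b \<in> Field \<kappa> then Some (l b x) else None)" for b
    have "t \<in> maps (Field \<kappa>) (Field \<kappa>)" unfolding in_maps_iff t_def using label_Field x by auto
    then obtain a where a: "a \<in> Field \<kappa>" "t |` underS \<kappa> a \<notin> T" using no_branch by blast
    moreover have "t |` underS \<kappa> a = hist (\<lambda>b. l b x) a"
      unfolding t_def hist_def using underS_subset_Field[of a]
      by (intro ext) (auto simp: restrict_map_def)
    ultimately have *: "hist (\<lambda>b. l b x) a \<notin> T" by simp
    show ?thesis
      using least_exists[of a "\<lambda>a. hist (\<lambda>b. l b x) a \<notin> T", OF a(1) *] by metis
  qed
  then obtain h where h: "\<And>x. x \<in> A \<Longrightarrow> h x \<in> Field \<kappa>" "\<And>x. x \<in> A \<Longrightarrow> hist (\<lambda>b. l b x) (h x) \<notin> T"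
    "\<And>x b. x \<in> A \<Longrightarrow> b \<in> underS \<kappa> (h x) \<Longrightarrow> hist (\<lambda>b. l b x) b \<in> T"
    by metis
  have "locally_constant_on X A h"
    unfolding locally_constant_on_def
  proof
    fix x assume x: "x \<in> A"
    let ?U = "{y \<in> A. \<forall>b\<in>underS \<kappa> (h x). l b y = l b x}"
    have "openin X ?U" by (rule label_cell_open[OF h(1)[OF x]])
    moreover have "h y = h x" if y: "y \<in> ?U" for y
    proof -
      have yA: "y \<in> A" using y by blast
      have eq: "hist (\<lambda>b. l b y) c = hist (\<lambda>b. l b x) c" if "c \<in> under \<kappa> (h x)" for c
        by (rule hist_cong) (use y underS_mono[OF that] in blast)
      have "h x \<in> under \<kappa> (h x)" using under_eq_insert[OF h(1)[OF x]] by blast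
      then have "h x \<notin> underS \<kappa> (h y)" using eq h(3)[OF yA] h(2)[OF x] by metis
      moreover have "h y \<notin> underS \<kappa> (h x)"
        using eq[of "h y"] h(3)[OF x] h(2)[OF yA] underS_subset_under by (metis subsetD)
      ultimately show ?thesis using underS_linear[OF h(1)[OF x] h(1)[OF yA]] by auto
    qed
    ultimately show "\<exists>U. openin X U \<and> x \<in> U \<and> U \<subseteq> A \<and> (\<forall>y\<in>U. h y = h x)"
      using x by (intro exI[of _ ?U]) blast
  qed
  moreover have "cofinal (h ` A) \<kappa>"
    unfolding cofinal_def
  proof
    fix d assume d: "d \<in> Field \<kappa>"
    obtain t where t: "t \<in> T" "t \<in> maps (underS \<kappa> d) (Field \<kappa>)" using levels(1)[OF d] by blast
    define z where "z b = the (t b)" for b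
    have tz: "t b = Some (z b)" "z b \<in> Field \<kappa>" if "b \<in> underS \<kappa> d" for b
      using t(2) that unfolding in_maps_iff z_def by auto
    have restr: "hist z a = t |` underS \<kappa> a" if "a \<in> under \<kappa> d" for a
      using tz underS_mono[OF that] unfolding hist_def by (intro ext) (auto simp: restrict_map_def)
    have "z b \<in> K b z" if b: "b \<in> underS \<kappa> d" for b
    proof -
      have bF: "b \<in> Field \<kappa>" using b underS_subset_Field by blast
      obtain c where c: "c \<in> Field \<kappa>" "underS \<kappa> c = under \<kappa> b" using successor_exists[OF bF] .
      have "(hist z b)(b \<mapsto> z b) = t |` underS \<kappa> c"
        unfolding c(2) under_eq_insert[OF bF] hist_def using tz underS_trans[OF _ b] b
        by (intro ext) (auto simp: restrict_map_def)
      then have "(hist z b)(b \<mapsto> z b) \<in> T" using T t(1) c(1) unfolding seq_tree_def by auto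
      then have "z b \<in> L b z" using tz[OF b] unfolding L_def by blast
      then show ?thesis unfolding K_def by auto
    qed
    then obtain x where x: "x \<in> A" "\<forall>b\<in>underS \<kappa> d. l b x = z b"
      using labels_realized[OF ofilter_underS A(2), of d z] by blast
    have "h x \<notin> under \<kappa> d"
    proof
      assume hx: "h x \<in> under \<kappa> d"
      have "hist (\<lambda>b. l b x) (h x) = hist z (h x)"
        by (rule hist_cong) (use x(2) underS_mono[OF hx] in blast)
      also have "\<dots> = t |` underS \<kappa> (h x)" by (rule restr[OF hx])
      also have "\<dots> \<in> T" using T t(1) h(1)[OF x(1)] unfolding seq_tree_def by blast
      finally show False using h(2)[OF x(1)] by blast
    qed
    then have "d \<in> underS \<kappa> (h x)"
      using underS_linear[OF d h(1)[OF x(1)]] under_eq_insert[OF d] by blast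
    then show "\<exists>b\<in>h ` A. d \<noteq> b \<and> (d, b) \<in> \<kappa>" using x(1) unfolding underS_def by blast
  qed
  then have "|h ` A| =o \<kappa>"
    using regular h(1) unfolding regularCard_def by blast
  then have "|Field \<kappa>| \<le>o |h ` A|"
    by (rule ordIso_ordLeq_trans[OF card_Field ordIso_imp_ordLeq[OF ordIso_symmetric]])
  ultimately show "\<exists>h :: 'a \<Rightarrow> 'k. locally_constant_on X A h \<and> |Field \<kappa>| \<le>o |h ` A|"
    by (intro exI[of _ h] conjI)
qed

text \<open>
  Failure of strong inaccessibility means \<open>2\<^sup>r \<ge> \<kappa>\<close> for some cardinal \<open>r < \<kappa>\<close>, and such an \<open>r\<close> is
  at most the size of some \<open>underS \<kappa> a\<close>.
\<close>

lemma not_weakly_compact_splits: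
  assumes "\<not> weakly_compact \<kappa>"
  shows "splits_onto X (Field \<kappa>)"
proof (cases "strongly_inaccessible \<kappa>")
  case True
  then obtain T where "seq_tree \<kappa> T"
    "\<forall>a\<in>Field \<kappa>. T \<inter> maps (underS \<kappa> a) (Field \<kappa>) \<noteq> {} \<and> |T \<inter> maps (underS \<kappa> a) (Field \<kappa>)| <o \<kappa>"
    "\<not> (\<exists>x\<in>maps (Field \<kappa>) (Field \<kappa>). \<forall>a\<in>Field \<kappa>. x |` underS \<kappa> a \<in> T)"
    using assms unfolding weakly_compact_def by blast
  then show ?thesis by (intro tree_splits) blast+
next
  case False
  then obtain r :: "'k rel" where r: "Card_order r" "r <o \<kappa>" "\<not> ctwo ^c r <o \<kappa>"
    using card_order uncountable regular unfolding strongly_inaccessible_def by blast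
  have W: "Well_order \<kappa>" using card_order by (simp add: card_order_on_well_order_on)
  have Wr: "Well_order r" using r(1) by (simp add: card_order_on_well_order_on)
  obtain a where a: "a \<in> Field \<kappa>" "r =o Restr \<kappa> (underS \<kappa> a)"
    using r(2) internalize_ordLess[of r \<kappa>] ordLess_iff_ordIso_Restr[OF W Wr] by blast
  have "|Field r| =o |Field (Restr \<kappa> (underS \<kappa> a))|" by (rule card_of_cong[OF a(2)])
  moreover have "|Field (Restr \<kappa> (underS \<kappa> a))| \<le>o |underS \<kappa> a|"
    by (rule card_of_mono1) (auto simp: Field_def)
  ultimately have "|Field r| \<le>o |underS \<kappa> a|" by (rule ordIso_ordLeq_trans)
  then obtain e where "inj_on e (Field r)" "e ` Field r \<subseteq> underS \<kappa> a"
    unfolding card_of_ordLeq[symmetric] by auto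
  then have "inj_on ((`) e) (Pow (Field r)) \<and> (`) e ` Pow (Field r) \<subseteq> Pow (underS \<kappa> a)"
    using inj_on_image_Pow image_Pow_mono by blast
  then have "|Pow (Field r)| \<le>o |Pow (underS \<kappa> a)|"
    unfolding card_of_ordLeq[symmetric] by (rule exI[of _ "(`) e"])
  moreover have "\<kappa> \<le>o ctwo ^c r"
    using r(3) not_ordLess_iff_ordLeq[OF W, of "ctwo ^c r"] by (simp add: cexp_def card_of_Well_order)
  moreover have "ctwo ^c r =o |Pow (Field r)|"
    unfolding cexp_def ctwo_def Field_card_of by (rule ordIso_symmetric[OF card_of_Pow_Func])
  ultimately have "\<kappa> \<le>o |Pow (underS \<kappa> a)|"
    by (meson ordLeq_ordIso_trans ordLeq_transitive)
  then show ?thesis by (rule large_power_splits[OF a(1)])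
qed

section \<open>The homeomorphism with the generalized Baire space\<close>

text \<open>
  The labels only serve to enforce \<open>\<kappa>\<close> pieces in every cell: they exhaust \<open>\<kappa>\<close> and are determined by
  the indices within the cell, so the indices exhaust \<open>\<kappa>\<close> as well. Then every index
  sequence is realised, by induction on its length.
\<close>

theorem homeomorphic_gen_baire:
  assumes split: "splits_onto X (Field \<kappa>)" and ne: "topspace X \<noteq> {}"
  shows "X homeomorphic_space gen_baire \<kappa>"
proof -
  define A where "A = topspace X"
  have A: "openin X A" "A \<noteq> {}" using ne by (simp_all add: A_def)
  obtain f l where "tree_coding \<kappa> X A (\<lambda>_ _. Field \<kappa>) f l"
    by (rule coding_exists[OF X_additive X_SC A(1), of "\<lambda>_ _. Field \<kappa>"]) (use split in blast)+
  then interpret tree_coding \<kappa> X A "\<lambda>_ _. Field \<kappa>" f l .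
  have full: "f a ` {y \<in> A. \<forall>b\<in>underS \<kappa> a. f b y = f b x} = Field \<kappa>"
    if a: "a \<in> Field \<kappa>" and x: "x \<in> A" for a x
  proof (rule index_full[OF a x])
    let ?C = "{y \<in> A. \<forall>b\<in>underS \<kappa> a. f b y = f b x}"
    have same: "l a y = l a w" if "y \<in> ?C" "w \<in> ?C" "f a y = f a w" for y w
      by (rule label_determined[OF a]) (use that under_eq_insert[OF a] in auto)
    define g where "g i = l a (SOME y. y \<in> ?C \<and> f a y = i)" for i
    have "g (f a y) = l a y" if y: "y \<in> ?C" for y
    proof -
      have *: "(SOME w. w \<in> ?C \<and> f a w = f a y) \<in> ?C \<and> f a (SOME w. w \<in> ?C \<and> f a w = f a y) = f a y"
        by (rule someI[of "\<lambda>w. w \<in> ?C \<and> f a w = f a y" y]) (use y in blast)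
      show ?thesis unfolding g_def by (rule same) (use * y in blast)+
    qed
    then have "g ` f a ` ?C = l a ` ?C" unfolding image_image by (rule image_cong[OF refl])
    then have "|l a ` ?C| \<le>o |f a ` ?C|" using card_of_image[of g "f a ` ?C"] by simp
    then show "|Field \<kappa>| \<le>o |f a ` ?C|" unfolding labels_of_cell[OF a x] .
  qed
  have realized: "\<exists>x\<in>A. \<forall>b\<in>Field \<kappa>. f b x = z b" if z: "\<And>b. b \<in> Field \<kappa> \<Longrightarrow> z b \<in> Field \<kappa>" for z
  proof (rule segment_realized[OF ofilter_Field A(2)])
    fix a assume "a \<in> Field \<kappa>"
    then show "\<exists>x\<in>A. \<forall>b\<in>under \<kappa> a. f b x = z b"
    proof (induction rule: below_induct)
      case (step a)
      obtain x where x: "x \<in> A" "\<forall>b\<in>underS \<kappa> a. f b x = z b"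
        using segment_realized[OF ofilter_underS A(2) step(2)] by blast
      have "z a \<in> f a ` {y \<in> A. \<forall>b\<in>underS \<kappa> a. f b y = f b x}"
        unfolding full[OF step(1) x(1)] by (rule z[OF step(1)])
      then obtain y where "y \<in> A" "\<forall>b\<in>underS \<kappa> a. f b y = f b x" "f a y = z a" by auto
      then show ?case using x(2) under_eq_insert[OF step(1)] by auto
    qed
  qed
  let ?M = "maps (Field \<kappa>) (Field \<kappa>)"
  define F where "F x = (\<lambda>a. if a \<in> Field \<kappa> then Some (f a x) else None)" for x
  have FM: "F x \<in> ?M" if "x \<in> A" for x
    unfolding in_maps_iff F_def using index_in_Field that by auto
  have F_agree: "agree a (F y) (F x) \<longleftrightarrow> (\<forall>b\<in>underS \<kappa> a. f b y = f b x)" for a x y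
    using underS_subset_Field[of a] unfolding agree_def F_def by auto
  have image: "F ` A = ?M"
  proof
    show "F ` A \<subseteq> ?M" using FM by blast
    show "?M \<subseteq> F ` A"
    proof
      fix t assume t: "t \<in> ?M"
      have "the (t b) \<in> Field \<kappa>" if "b \<in> Field \<kappa>" for b using t that unfolding in_maps_iff by auto
      then obtain x where x: "x \<in> A" "\<forall>b\<in>Field \<kappa>. f b x = the (t b)"
        using realized[of "\<lambda>b. the (t b)"] by blast
      have "F x = t"
      proof
        fix b show "F x b = t b"
          using x(2) t unfolding in_maps_iff F_def by (cases "b \<in> Field \<kappa>") auto
      qed
      then show "t \<in> F ` A" using x(1) by blast
    qed
  qed
  have cont: "continuous_map X (gen_baire \<kappa>) F"
    unfolding continuous_map_def
  proof (intro conjI allI impI)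
    show "F \<in> topspace X \<rightarrow> topspace (gen_baire \<kappa>)"
      using FM unfolding topspace_gen_baire A_def by blast
    fix U assume U: "openin (gen_baire \<kappa>) U"
    show "openin X {x \<in> topspace X. F x \<in> U}"
    proof (subst openin_subopen, intro ballI)
      fix x assume x: "x \<in> {x \<in> topspace X. F x \<in> U}"
      then obtain a where a: "a \<in> Field \<kappa>" "\<forall>y\<in>?M. agree a y (F x) \<longrightarrow> y \<in> U"
        using U unfolding openin_gen_baire by blast
      let ?C = "{y \<in> A. \<forall>b\<in>underS \<kappa> a. f b y = f b x}"
      have xA: "x \<in> A" using x by (simp add: A_def)
      have "openin X ?C" by (rule cell_open[OF a(1) xA])
      moreover have "?C \<subseteq> {x \<in> topspace X. F x \<in> U}"
        using a(2) FM F_agree[of a _ x] unfolding A_def by blast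
      ultimately show "\<exists>T. openin X T \<and> x \<in> T \<and> T \<subseteq> {x \<in> topspace X. F x \<in> U}"
        using xA by (intro exI[of _ ?C]) simp
    qed
  qed
  have "open_map X (gen_baire \<kappa>) F"
    unfolding open_map_def openin_gen_baire
  proof (intro allI impI conjI ballI)
    fix U assume U: "openin X U"
    have UA: "U \<subseteq> A" using openin_subset[OF U] by (simp add: A_def)
    then show "F ` U \<subseteq> ?M" using FM by blast
    fix t assume "t \<in> F ` U"
    then obtain x where x: "x \<in> U" "t = F x" by blast
    obtain a where a: "a \<in> Field \<kappa>" "\<forall>y\<in>A. (\<forall>b\<in>underS \<kappa> a. f b y = f b x) \<longrightarrow> y \<in> U"
      using cell_base[OF _ U x(1)] x(1) UA by blast
    have "y \<in> F ` U" if y: "y \<in> ?M" "agree a y t" for y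
    proof -
      obtain w where w: "w \<in> A" "y = F w" using y(1) image by blast
      then show ?thesis using y(2) a(2) F_agree[of a w x] x(2) by blast
    qed
    then show "\<exists>a\<in>Field \<kappa>. \<forall>y\<in>?M. agree a y t \<longrightarrow> y \<in> F ` U" using a(1) by blast
  qed
  moreover have "inj_on F (topspace X)"
  proof (rule inj_onI, rule ccontr)
    fix x y assume xy: "x \<in> topspace X" "y \<in> topspace X" "F x = F y" "x \<noteq> y"
    have "Hausdorff_space X" using X_SC unfolding SC_space_def by blast
    then obtain U where U: "openin X U" "x \<in> U" "y \<notin> U"
      using xy unfolding Hausdorff_space_def disjnt_def by blast
    obtain a where "a \<in> Field \<kappa>" "\<forall>y\<in>A. (\<forall>b\<in>underS \<kappa> a. f b y = f b x) \<longrightarrow> y \<in> U"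
      using cell_base[OF _ U(1,2)] xy(1) unfolding A_def by blast
    moreover have "agree a (F y) (F x)" for a using xy(3) by (simp add: agree_def)
    ultimately show False using U(3) xy(2) unfolding F_agree A_def by blast
  qed
  ultimately have "homeomorphic_map X (gen_baire \<kappa>) F"
    using bijective_open_imp_homeomorphic_map[OF cont] image unfolding topspace_gen_baire A_def by blast
  then show ?thesis by (rule homeomorphic_map_imp_homeomorphic_space)
qed

end


section \<open>Spaces of sequences over a given alphabet\<close>

text \<open>
  The Baire and the Cantor space are treated together as the spaces of sequences over an
  alphabet \<open>Q\<close> with at least two letters.
\<close>

definition seq_space :: "'k set \<Rightarrow> ('k \<rightharpoonup> 'k) topology" where
  "seq_space Q = subtopology (gen_baire \<kappa>) (maps (Field \<kappa>) Q)"

lemma gen_baire_eq: "gen_baire \<kappa> = seq_space (Field \<kappa>)"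
  unfolding seq_space_def topspace_gen_baire[symmetric] by simp

lemma gen_cantor_eq: "gen_cantor \<kappa> = seq_space (two \<kappa>)"
  by (simp add: gen_cantor_def seq_space_def)

lemma agree_refl: "agree a x x"
  by (simp add: agree_def)

lemma agree_sym: "agree a x y \<Longrightarrow> agree a y x"
  by (simp add: agree_def)

lemma agree_trans: "agree a x y \<Longrightarrow> agree a y z \<Longrightarrow> agree a x z"
  by (simp add: agree_def)

lemma two_eq_distinct_pair: 
  obtains u v where "two \<kappa> = {u, v}" "u \<noteq> v" "u \<in> Field \<kappa>" "v \<in> Field \<kappa>"
proof -
  define u where "u = wo_rel.minim \<kappa> (Field \<kappa>)"
  define v where "v = wo_rel.suc \<kappa> {u}"
  have "Field \<kappa> \<noteq> {}" using infinite_Field by auto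
  then have u: "u \<in> Field \<kappa>"
    unfolding u_def by (intro wo_rel.minim_in[OF well_order]) auto
  obtain c where c: "c \<in> Field \<kappa>" "u \<in> underS \<kappa> c" using greater_exists[OF u] .
  have "AboveS \<kappa> {u} \<noteq> {}" using c unfolding AboveS_def underS_def by blast
  then have v: "v \<noteq> u" "v \<in> Field \<kappa>"
    using wo_rel.suc_greater[OF well_order, of "{u}" u] wo_rel.suc_inField[OF well_order, of "{u}"] u
    unfolding v_def by auto
  have "two \<kappa> = {u, v}" unfolding two_def u_def v_def Let_def ..
  then show ?thesis using that u v by blast
qed

context
  fixes Q :: "'k set" and u v :: 'k
  assumes Q: "Q \<subseteq> Field \<kappa>" and uv: "u \<in> Q" "v \<in> Q" "u \<noteq> v"
begin

lemma maps_subset: "maps (Field \<kappa>) Q \<subseteq> maps (Field \<kappa>) (Field \<kappa>)"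
  using Q unfolding maps_def by auto

lemma topspace_seq: "topspace (seq_space Q) = maps (Field \<kappa>) Q"
  using maps_subset unfolding seq_space_def topspace_subtopology topspace_gen_baire by blast

lemma openin_seq:
  "openin (seq_space Q) U \<longleftrightarrow>
     U \<subseteq> maps (Field \<kappa>) Q \<and>
     (\<forall>x\<in>U. \<exists>a\<in>Field \<kappa>. \<forall>y\<in>maps (Field \<kappa>) Q. agree a y x \<longrightarrow> y \<in> U)"
    (is "_ \<longleftrightarrow> U \<subseteq> ?M \<and> ?nb")
proof
  assume "openin (seq_space Q) U"
  then obtain V where V: "openin (gen_baire \<kappa>) V" "U = V \<inter> ?M"
    unfolding seq_space_def openin_subtopology by blast
  have ?nb
  proof
    fix x assume "x \<in> U"
    then obtain a where "a \<in> Field \<kappa>" "\<forall>y\<in>maps (Field \<kappa>) (Field \<kappa>). agree a y x \<longrightarrow> y \<in> V"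
      using V unfolding openin_gen_baire by blast
    then show "\<exists>a\<in>Field \<kappa>. \<forall>y\<in>?M. agree a y x \<longrightarrow> y \<in> U" using V(2) maps_subset by blast
  qed
  then show "U \<subseteq> ?M \<and> ?nb" using V(2) by blast
next
  assume U: "U \<subseteq> ?M \<and> ?nb"
  define V where "V = {z \<in> maps (Field \<kappa>) (Field \<kappa>).
    \<exists>x\<in>U. \<exists>a\<in>Field \<kappa>. (\<forall>y\<in>?M. agree a y x \<longrightarrow> y \<in> U) \<and> agree a z x}"
  have "openin (gen_baire \<kappa>) V"
    unfolding openin_gen_baire
  proof (intro conjI ballI)
    fix z assume "z \<in> V"
    then obtain x a where xa: "x \<in> U" "a \<in> Field \<kappa>" "\<forall>y\<in>?M. agree a y x \<longrightarrow> y \<in> U" "agree a z x"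
      unfolding V_def by blast
    have "\<forall>y\<in>maps (Field \<kappa>) (Field \<kappa>). agree a y z \<longrightarrow> y \<in> V"
      using xa agree_trans[of a _ z x] unfolding V_def by blast
    then show "\<exists>a\<in>Field \<kappa>. \<forall>y\<in>maps (Field \<kappa>) (Field \<kappa>). agree a y z \<longrightarrow> y \<in> V"
      using xa(2) by blast
  qed (auto simp: V_def)
  moreover have "U = V \<inter> ?M"
  proof
    show "U \<subseteq> V \<inter> ?M" using U maps_subset agree_refl unfolding V_def by blast
    show "V \<inter> ?M \<subseteq> U" unfolding V_def by blast
  qed
  ultimately show "openin (seq_space Q) U" unfolding seq_space_def openin_subtopology by blast
qed

lemma openin_cylinder:
  assumes "a \<in> Field \<kappa>" shows "openin (seq_space Q) {y \<in> maps (Field \<kappa>) Q. agree a y x}"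
  unfolding openin_seq using assms agree_trans by blast

lemma closedin_cylinder:
  assumes "a \<in> Field \<kappa>" shows "closedin (seq_space Q) {y \<in> maps (Field \<kappa>) Q. agree a y x}"
proof -
  have "openin (seq_space Q) (maps (Field \<kappa>) Q - {y \<in> maps (Field \<kappa>) Q. agree a y x})"
    unfolding openin_seq using assms agree_trans agree_sym by blast
  then show ?thesis unfolding closedin_def topspace_seq by blast
qed

lemma seq_nonempty: "topspace (seq_space Q) \<noteq> {}"
proof -
  have "(\<lambda>b. if b \<in> Field \<kappa> then Some u else None) \<in> maps (Field \<kappa>) Q"
    unfolding in_maps_iff using uv by simp
  then show ?thesis unfolding topspace_seq by blast
qed

lemma seq_additive: "additive_space \<kappa> (seq_space Q)"
  unfolding additive_space_def
proof (intro allI impI)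
  fix \<U> assume \<U>: "(\<forall>U\<in>\<U>. openin (seq_space Q) U) \<and> |\<U>| <o \<kappa>"
  show "openin (seq_space Q) (topspace (seq_space Q) \<inter> \<Inter>\<U>)"
    unfolding topspace_seq openin_seq
  proof (intro conjI ballI)
    fix x assume x: "x \<in> maps (Field \<kappa>) Q \<inter> \<Inter>\<U>"
    have "\<exists>a. a \<in> Field \<kappa> \<and> (\<forall>y\<in>maps (Field \<kappa>) Q. agree a y x \<longrightarrow> y \<in> U)" if "U \<in> \<U>" for U
    proof -
      have "openin (seq_space Q) U" "x \<in> U" using \<U> x that by auto
      then show ?thesis unfolding openin_seq by blast
    qed
    then have "\<forall>U\<in>\<U>. \<exists>a. a \<in> Field \<kappa> \<and> (\<forall>y\<in>maps (Field \<kappa>) Q. agree a y x \<longrightarrow> y \<in> U)"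
      by (rule ballI)
    then obtain a where a: "\<forall>U\<in>\<U>. a U \<in> Field \<kappa> \<and> (\<forall>y\<in>maps (Field \<kappa>) Q. agree (a U) y x \<longrightarrow> y \<in> U)"
      by (rule exE[OF bchoice])
    have "a ` \<U> \<subseteq> Field \<kappa>" using a by blast
    moreover have "|a ` \<U>| <o \<kappa>" by (rule small_image) (simp add: \<U>)
    ultimately obtain c where c: "c \<in> Field \<kappa>" "a ` \<U> \<subseteq> underS \<kappa> c" by (rule small_bounded)
    have "y \<in> U" if "y \<in> maps (Field \<kappa>) Q" "agree c y x" "U \<in> \<U>" for y U
    proof -
      have "a U \<in> under \<kappa> c" using c(2) that(3) underS_subset_under by fast
      then have "agree (a U) y x" by (rule agree_mono[OF that(2)])
      then show ?thesis using a that(1,3) by blast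
    qed
    then show "\<exists>a\<in>Field \<kappa>. \<forall>y\<in>maps (Field \<kappa>) Q. agree a y x \<longrightarrow> y \<in> maps (Field \<kappa>) Q \<inter> \<Inter>\<U>"
      using c(1) by blast
  qed blast
qed

lemma seq_perfect: "perfect_space (seq_space Q)"
  unfolding perfect_space_def topspace_seq
proof (intro ballI notI)
  fix x assume x: "x \<in> maps (Field \<kappa>) Q" and "openin (seq_space Q) {x}"
  then obtain a where a: "a \<in> Field \<kappa>" "\<forall>y\<in>maps (Field \<kappa>) Q. agree a y x \<longrightarrow> y \<in> {x}"
    unfolding openin_seq by blast
  define c where "c = (if x a = Some u then v else u)"
  have "x(a \<mapsto> c) \<in> maps (Field \<kappa>) Q"
    using x a(1) uv unfolding in_maps_iff c_def by auto
  moreover have "agree a (x(a \<mapsto> c)) x" using underS_irrefl by (auto simp: agree_def)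
  ultimately have "x(a \<mapsto> c) = x" using a(2) by blast
  then have "x a = Some c" by (metis fun_upd_same)
  then show False using uv(3) unfolding c_def by (auto split: if_splits)
qed

lemma seq_regular: "regular_space (seq_space Q)"
  unfolding regular_space_def
proof (intro allI impI)
  fix C x assume Cx: "closedin (seq_space Q) C \<and> x \<in> topspace (seq_space Q) - C"
  then have "openin (seq_space Q) (topspace (seq_space Q) - C)" by blast
  then obtain a where a: "a \<in> Field \<kappa>"
    "\<forall>y\<in>maps (Field \<kappa>) Q. agree a y x \<longrightarrow> y \<in> topspace (seq_space Q) - C"
    using Cx unfolding openin_seq by blast
  let ?N = "{y \<in> maps (Field \<kappa>) Q. agree a y x}"
  have "openin (seq_space Q) (topspace (seq_space Q) - ?N)"
    using closedin_cylinder[OF a(1)] by blast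
  moreover have "x \<in> ?N" using Cx agree_refl unfolding topspace_seq by blast
  moreover have "C \<subseteq> topspace (seq_space Q) - ?N"
    using closedin_subset[of "seq_space Q" C] Cx a(2) by blast
  moreover have "disjnt ?N (topspace (seq_space Q) - ?N)" by (auto simp: disjnt_def)
  ultimately show "\<exists>U V. openin (seq_space Q) U \<and> openin (seq_space Q) V \<and> x \<in> U \<and> C \<subseteq> V \<and> disjnt U V"
    using openin_cylinder[OF a(1), of x]
    by (intro exI[of _ ?N] exI[of _ "topspace (seq_space Q) - ?N"]) simp
qed

lemma seq_Hausdorff: "Hausdorff_space (seq_space Q)"
  unfolding Hausdorff_space_def topspace_seq
proof (intro allI impI)
  fix x y assume xy: "x \<in> maps (Field \<kappa>) Q \<and> y \<in> maps (Field \<kappa>) Q \<and> x \<noteq> y"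
  then obtain b where b: "x b \<noteq> y b" by blast
  then have bF: "b \<in> Field \<kappa>" using xy unfolding in_maps_iff by metis
  obtain c where c: "c \<in> Field \<kappa>" "b \<in> underS \<kappa> c" using greater_exists[OF bF] .
  let ?N = "\<lambda>x. {y \<in> maps (Field \<kappa>) Q. agree c y x}"
  have "\<not> agree c x y" using b c(2) unfolding agree_def by blast
  then have "disjnt (?N x) (?N y)"
    using agree_trans agree_sym unfolding disjnt_def by blast
  then show "\<exists>U V. openin (seq_space Q) U \<and> openin (seq_space Q) V \<and> x \<in> U \<and> y \<in> V \<and> disjnt U V"
    using openin_cylinder[OF c(1)] xy agree_refl by (intro exI[of _ "?N x"] exI[of _ "?N y"]) blast
qed

text \<open>
  II answers the move \<open>(U, x)\<close> with a cylinder around \<open>x\<close> inside \<open>U\<close>. The cylinders played in the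
  course of a run are given by pairwise compatible sequences, so their union extends to a
  point that lies in all of them.
\<close>

definition cylinder_strategy :: "('k, 'k \<rightharpoonup> 'k) strategy_II" where
  "cylinder_strategy a p =
     {y \<in> maps (Field \<kappa>) Q.
        agree (SOME c. c \<in> Field \<kappa> \<and>
                 {y \<in> maps (Field \<kappa>) Q. agree c y (snd (p a))} \<subseteq> fst (p a)) y (snd (p a))}"

lemma seq_winning: "winning_strategy_II \<kappa> (seq_space Q) cylinder_strategy"
  unfolding winning_strategy_II_def
proof (intro allI impI, elim conjE)
  fix p D
  let ?M = "maps (Field \<kappa>) Q" and ?V = "response \<kappa> cylinder_strategy p"
  assume D: "wo_rel.ofilter \<kappa> D" and I: "\<forall>a\<in>D. legal_I \<kappa> (seq_space Q) p ?V a"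
  define c where "c a = (SOME c. c \<in> Field \<kappa> \<and> {y \<in> ?M. agree c y (snd (p a))} \<subseteq> fst (p a))" for a
  have DF: "a \<in> Field \<kappa>" if "a \<in> D" for a using segment_subset_Field[OF D] that by blast
  have V: "?V a = {y \<in> ?M. agree (c a) y (snd (p a))}" if "a \<in> Field \<kappa>" for a
    using under_eq_insert[OF that] unfolding response_def cylinder_strategy_def c_def by simp
  have V_open: "openin (seq_space Q) (?V a)" if a: "a \<in> Field \<kappa>" for a
  proof (cases "c a \<in> Field \<kappa>")
    case True
    then show ?thesis unfolding V[OF a] by (rule openin_cylinder)
  next
    \<comment> \<open>If \<open>c a\<close> is not below \<open>\<kappa>\<close>, which only an illegal move of I may cause, II plays the whole space.\<close>
    case False
    then have "underS \<kappa> (c a) = {}" by (rule underS_empty)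
    then have "?V a = topspace (seq_space Q)" unfolding V[OF a] topspace_seq agree_def by simp
    then show ?thesis by simp
  qed
  have region_open: "openin (seq_space Q) (game_region \<kappa> (seq_space Q) ?V a)" if "a \<in> Field \<kappa>" for a
    unfolding game_region_def
    by (rule additive_INT[OF seq_additive small_underS[OF that]]) (use V_open underS_subset_Field in blast)
  have U: "openin (seq_space Q) (fst (p a))" "fst (p a) \<subseteq> game_region \<kappa> (seq_space Q) ?V a"
    "snd (p a) \<in> fst (p a)" if a: "a \<in> D" for a
    using I a openin_open_subtopology[OF region_open[OF DF[OF a]]] unfolding legal_I_def by blast+
  have c: "c a \<in> Field \<kappa>" "?V a \<subseteq> fst (p a)" if a: "a \<in> D" for a
  proof -
    have "\<exists>c. c \<in> Field \<kappa> \<and> {y \<in> ?M. agree c y (snd (p a))} \<subseteq> fst (p a)"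
      using U(1,3)[OF a] unfolding openin_seq by blast
    then have "c a \<in> Field \<kappa> \<and> {y \<in> ?M. agree (c a) y (snd (p a))} \<subseteq> fst (p a)"
      unfolding c_def by (rule someI_ex)
    then show "c a \<in> Field \<kappa>" "?V a \<subseteq> fst (p a)" unfolding V[OF DF[OF a]] by blast+
  qed
  have xM: "snd (p a) \<in> ?M" if a: "a \<in> D" for a
    using U(1,3)[OF a] unfolding openin_seq by blast
  have legal: "legal_II \<kappa> (seq_space Q) p ?V a" if a: "a \<in> D" for a
  proof -
    have "snd (p a) \<in> ?V a" unfolding V[OF DF[OF a]] using xM[OF a] agree_refl by blast
    moreover have "openin (subtopology (seq_space Q) (game_region \<kappa> (seq_space Q) ?V a)) (?V a)"
      by (rule subset_openin_subtopology[OF V_open[OF DF[OF a]]]) (use c(2)[OF a] U(2)[OF a] in blast)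
    ultimately show ?thesis using c(2)[OF a] unfolding legal_II_def by blast
  qed
  have later: "agree (c a) (snd (p b)) (snd (p a))" if ab: "a \<in> D" "b \<in> D" "a \<in> underS \<kappa> b" for a b
  proof -
    have "snd (p b) \<in> ?V a" using U(2,3)[OF ab(2)] ab(3) unfolding game_region_def by blast
    then show ?thesis unfolding V[OF DF[OF ab(1)]] by blast
  qed
  have compat: "snd (p a) e = snd (p b) e"
    if "a \<in> D" "b \<in> D" "e \<in> underS \<kappa> (c a)" "e \<in> underS \<kappa> (c b)" for a b e
    using underS_linear[OF DF[OF that(1)] DF[OF that(2)]] later[OF that(1,2)] later[OF that(2,1)] that(3,4)
    unfolding agree_def by auto
  define z where "z e = (if e \<in> Field \<kappa>
      then (if \<exists>a\<in>D. e \<in> underS \<kappa> (c a) then snd (p (SOME a. a \<in> D \<and> e \<in> underS \<kappa> (c a))) e else Some u)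
      else None)" for e
  have z: "z e = snd (p a) e" if "a \<in> D" "e \<in> underS \<kappa> (c a)" for a e
  proof -
    let ?a = "SOME a. a \<in> D \<and> e \<in> underS \<kappa> (c a)"
    have "?a \<in> D \<and> e \<in> underS \<kappa> (c ?a)" by (rule someI[of _ a]) (use that in blast)
    then have "snd (p ?a) e = snd (p a) e" using compat that by blast
    moreover have "e \<in> Field \<kappa>" using that(2) underS_subset_Field by blast
    ultimately show ?thesis using that unfolding z_def by auto
  qed
  have "z \<in> ?M"
    unfolding in_maps_iff
  proof (intro conjI allI impI ballI)
    fix e assume e: "e \<in> Field \<kappa>"
    show "\<exists>d\<in>Q. z e = Some d"
    proof (cases "\<exists>a\<in>D. e \<in> underS \<kappa> (c a)")
      case True
      then obtain a where a: "a \<in> D" "e \<in> underS \<kappa> (c a)" by blast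
      then show ?thesis using z[OF a] xM[OF a(1)] e unfolding in_maps_iff by simp
    next
      case False
      then have "z e = Some u" unfolding z_def using e by simp
      then show ?thesis using uv(1) by blast
    qed
  qed (simp add: z_def)
  then have "z \<in> ?V a" if "a \<in> D" for a
    unfolding V[OF DF[OF that]] using z[OF that] by (simp add: agree_def)
  then show "(\<forall>a\<in>D. legal_II \<kappa> (seq_space Q) p ?V a) \<and>
      (limit_segment \<kappa> D \<longrightarrow> (\<Inter>a\<in>D. ?V a) \<noteq> {})"
    using legal by blast
qed

lemma seq_SC: "weight_le (seq_space Q) \<kappa> \<Longrightarrow> SC_space \<kappa> (seq_space Q)"
  unfolding SC_space_def using seq_regular seq_Hausdorff seq_winning by blast

lemma seq_weight:
  assumes "|bounded_seqs \<kappa> Q| \<le>o \<kappa>"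
  shows "weight_le (seq_space Q) \<kappa>"
proof -
  define N where "N s = {y \<in> maps (Field \<kappa>) Q. s \<subseteq>\<^sub>m y}" for s
  have "|N ` bounded_seqs \<kappa> Q| \<le>o \<kappa>" by (rule ordLeq_transitive[OF card_of_image assms])
  moreover have "openin (seq_space Q) (N s)" if s: "s \<in> bounded_seqs \<kappa> Q" for s
  proof -
    obtain a where a: "a \<in> Field \<kappa>" "dom s = underS \<kappa> a"
      using s unfolding bounded_seqs_def maps_def by blast
    have "y \<in> N s" if "y \<in> maps (Field \<kappa>) Q" "agree a y x" "x \<in> N s" for x y
      using that a(2) unfolding N_def map_le_def agree_def by simp
    then show ?thesis unfolding openin_seq using a(1) N_def by blast
  qed
  moreover have "\<exists>V\<in>N ` bounded_seqs \<kappa> Q. x \<in> V \<and> V \<subseteq> U"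
    if U: "openin (seq_space Q) U" "x \<in> U" for U x
  proof -
    obtain a where a: "a \<in> Field \<kappa>" "\<forall>y\<in>maps (Field \<kappa>) Q. agree a y x \<longrightarrow> y \<in> U"
      using U unfolding openin_seq by blast
    have x: "x \<in> maps (Field \<kappa>) Q" using U unfolding openin_seq by blast
    have N: "y \<in> N (x |` underS \<kappa> a) \<longleftrightarrow> y \<in> maps (Field \<kappa>) Q \<and> agree a y x" for y
      using map_le_restrict_iff[OF x] unfolding N_def by blast
    have "x \<in> N (x |` underS \<kappa> a)" "N (x |` underS \<kappa> a) \<subseteq> U"
      using N x a(2) agree_refl by blast+
    then show ?thesis using restrict_bounded_seq[OF x a(1)] by blast
  qed
  ultimately show ?thesis
    unfolding weight_le_def by (intro exI[of _ "N ` bounded_seqs \<kappa> Q"]) simp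
qed

end

theorem perfect_SC_spaces_homeomorphic:
  assumes seqs: "|bounded_seqs \<kappa> (two \<kappa>)| =o \<kappa>" and nwc: "\<not> weakly_compact \<kappa>"
  shows "gen_cantor \<kappa> homeomorphic_space gen_baire \<kappa>"
    and "Y \<in> {gen_cantor \<kappa>, gen_baire \<kappa>} \<Longrightarrow>
      topspace Y \<noteq> {} \<and> additive_space \<kappa> Y \<and> perfect_space Y \<and> kappa_perfect_space \<kappa> Y \<and> SC_space \<kappa> Y"
    and "Y \<in> {gen_cantor \<kappa>, gen_baire \<kappa>} \<Longrightarrow> topspace X \<noteq> {} \<Longrightarrow> additive_space \<kappa> X \<Longrightarrow>
      perfect_space X \<Longrightarrow> SC_space \<kappa> X \<Longrightarrow> X homeomorphic_space Y"
proof -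
  obtain u v where uv: "two \<kappa> = {u, v}" "u \<noteq> v" "u \<in> Field \<kappa>" "v \<in> Field \<kappa>" by (rule two_eq_distinct_pair)
  have C: "two \<kappa> \<subseteq> Field \<kappa>" "u \<in> two \<kappa>" "v \<in> two \<kappa>" "u \<noteq> v" using uv by auto
  have B: "Field \<kappa> \<subseteq> Field \<kappa>" "u \<in> Field \<kappa>" "v \<in> Field \<kappa>" "u \<noteq> v" using uv by auto
  have SC_cantor: "SC_space \<kappa> (gen_cantor \<kappa>)"
    unfolding gen_cantor_eq by (rule seq_SC[OF C seq_weight[OF C ordIso_imp_ordLeq[OF seqs]]])
  show homeo: "gen_cantor \<kappa> homeomorphic_space gen_baire \<kappa>"
    using homeomorphic_gen_baire not_weakly_compact_splits nwc SC_cantor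
      seq_nonempty[OF C] seq_additive[OF C] seq_perfect[OF C] gen_cantor_eq by metis
  have SC_baire: "SC_space \<kappa> (gen_baire \<kappa>)"
  proof -
    have "weight_le (gen_baire \<kappa>) \<kappa>"
      using weight_le_homeomorphic[OF homeo] SC_cantor unfolding SC_space_def by blast
    then show ?thesis unfolding gen_baire_eq by (rule seq_SC[OF B])
  qed
  show "topspace Y \<noteq> {} \<and> additive_space \<kappa> Y \<and> perfect_space Y \<and> kappa_perfect_space \<kappa> Y \<and> SC_space \<kappa> Y"
    if "Y \<in> {gen_cantor \<kappa>, gen_baire \<kappa>}"
  proof -
    have "topspace Y \<noteq> {} \<and> additive_space \<kappa> Y \<and> perfect_space Y \<and> SC_space \<kappa> Y"
      using that SC_cantor SC_baire seq_nonempty[OF C] seq_additive[OF C] seq_perfect[OF C]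
        seq_nonempty[OF B] seq_additive[OF B] seq_perfect[OF B]
      unfolding gen_cantor_eq gen_baire_eq by blast
    then show ?thesis using perfect_iff_kappa_perfect by blast
  qed
  show "X homeomorphic_space Y"
    if "Y \<in> {gen_cantor \<kappa>, gen_baire \<kappa>}" and X: "topspace X \<noteq> {}" "additive_space \<kappa> X"
      "perfect_space X" "SC_space \<kappa> X"
  proof -
    have "X homeomorphic_space gen_baire \<kappa>"
      by (rule homeomorphic_gen_baire[OF X(2-4) not_weakly_compact_splits[OF X(2-4) nwc] X(1)])
    then show ?thesis
      using that(1) homeo homeomorphic_space_trans homeomorphic_space_sym by blast
  qed
qed

end

theorem theorem3p13:
  fixes \<kappa> :: "'k rel"
  assumes "Card_order \<kappa>"
    and "natLeq <o \<kappa>"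
    and "regularCard \<kappa>"
    and "|bounded_seqs \<kappa> (two \<kappa>)| =o \<kappa>"
    and "\<not> weakly_compact \<kappa>"
  shows "(\<forall>Y\<in>{gen_cantor \<kappa>, gen_baire \<kappa>}.
            (topspace Y \<noteq> {} \<and> additive_space \<kappa> Y \<and> perfect_space Y \<and>
             kappa_perfect_space \<kappa> Y \<and> SC_space \<kappa> Y) \<and>
            (\<forall>X :: 'a topology.
               topspace X \<noteq> {} \<and> additive_space \<kappa> X \<and> perfect_space X \<and> SC_space \<kappa> X
               \<longrightarrow> X homeomorphic_space Y)) \<and>
         gen_baire \<kappa> homeomorphic_space gen_cantor \<kappa> \<and>
         (\<forall>X :: 'a topology. regular_space X \<and> Hausdorff_space X \<and> additive_space \<kappa> X
            \<longrightarrow> (perfect_space X \<longleftrightarrow> kappa_perfect_space \<kappa> X))"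
proof -
  interpret regular_uncountable \<kappa> by unfold_locales (fact assms)+
  note facts = perfect_SC_spaces_homeomorphic[OF assms(4,5)]
  show ?thesis
  proof (intro conjI)
    show "\<forall>Y\<in>{gen_cantor \<kappa>, gen_baire \<kappa>}.
            (topspace Y \<noteq> {} \<and> additive_space \<kappa> Y \<and> perfect_space Y \<and>
             kappa_perfect_space \<kappa> Y \<and> SC_space \<kappa> Y) \<and>
            (\<forall>X :: 'a topology.
               topspace X \<noteq> {} \<and> additive_space \<kappa> X \<and> perfect_space X \<and> SC_space \<kappa> X
               \<longrightarrow> X homeomorphic_space Y)"
      by (intro ballI conjI[OF facts(2)] allI impI, assumption, elim conjE, rule facts(3))
    show "gen_baire \<kappa> homeomorphic_space gen_cantor \<kappa>"
      by (rule homeomorphic_space_sym[THEN iffD1, OF facts(1)])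
    show "\<forall>X :: 'a topology. regular_space X \<and> Hausdorff_space X \<and> additive_space \<kappa> X
            \<longrightarrow> (perfect_space X \<longleftrightarrow> kappa_perfect_space \<kappa> X)"
      by (intro allI impI, elim conjE, rule perfect_iff_kappa_perfect)
  qed
qed

end
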